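(* Let $M$ be a smooth spacetime and let $U\subseteq M$ be open. Then $$\mathrm{Chron}^-(U)\subseteq\mathrm{Cov}^-_{\trianglelefteq}(U),$$ where $\trianglelefteq$ is the Egli–Milner order on the open subsets of $M$ induced by the causality relation.
   Context: A smooth spacetime is a smooth connected Lorentzian manifold $M$ with time orientation. The causality relation $x\preceq y$ (a preorder) holds when $x=y$ or there is a future-directed causal curve from $x$ to $y$; the chronology relation $x\ll y$ holds when there is a future-directed timelike curve from $x$ to $y$. For $A\subseteq M$, $J^\pm(A)$ and $I^\pm(A)$ are the future/past sets of $A$ with respect to $\preceq$ and $\ll$ respectively, and $I^-(x):=I^-(\{x\})$. Let $\mathcal{O}M$ be the frame of open subsets of $M$. For $A,U\in\mathcal{O}M$, write $A\in\mathrm{Chron}^-(U)$ ($A$ covers $U$ from below with timelike curves) if $A\subseteq I^-(U)$ and for every future-directed timelike curve $\gamma\colon[a,b]\to M$ with $\gamma(b)\in U$, either $\mathrm{im}(\gamma)\cap A\neq\varnothing$ or $I^-(\gamma(a))\cap A\neq\varnothing$. The Egli–Milner order on $\mathcal{O}M$ is: $U\trianglelefteq V$ iff $U\subseteq J^-(V)$ and $V\subseteq J^+(U)$. With it $M$ becomes an ordered locale, with localic cones $\Uparrow U:=\bigcup\{V\in\mathcal{O}M: U\trianglelefteq V\}$ and $\Downarrow U:=\bigcup\{W\in\mathcal{O}M: W\trianglelefteq U\}$; for every open $U$ one has $\Uparrow U=I^+(U)=J^+(U)$ and $\Downarrow U=I^-(U)=J^-(U)$. A path is a finite sequence $p=(p_n)_{n=0}^N$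 of non-empty open sets (steps) with $p_n\trianglelefteq p_{n+1}$ for $0\le n<N$; its endpoint is $p_\top=p_N$. It inhabits $V$ if $p_n\subseteq V$ for some $n$; it lands in $V$ if $p_\top\subseteq V$. A path $q$ refines $p$, written $q\Subset p$, if for every $n$ there is $m$ with $q_m\subseteq p_n$. For open $W\subseteq p_N$ the restriction $p|_W$ is defined by $(p|_W)_N:=W$ and $(p|_W)_n:=p_n\cap\Downarrow(p|_W)_{n+1}$ for $0\le n<N$. A local past refinement of $p$ is a family $(q^j)_{j\in J}$ of paths with $\bigcup_j q^j_\top=p_\top$ and $q^j\Subset p|_{q^j_\top}$ for all $j$. Finally $A\in\mathrm{Cov}^-_{\trianglelefteq}(U)$ if $A$ is open, $A\subseteq\Downarrow U$, and every path $p$ landing in $U$ has a local past refinement $(q^j)$ such that each $q^j$ inhabits $A$. *)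

theory Defs
  imports "HOL-Analysis.Analysis"
begin

section \<open>Smooth maps between Euclidean spaces\<close>

text \<open>Meant for open sets: all derivatives are the two-sided ones.\<close>

primrec Ck_on :: "nat \<Rightarrow> 'a::real_normed_vector set \<Rightarrow> ('a \<Rightarrow> 'b::real_normed_vector) \<Rightarrow> bool" where
  "Ck_on 0 X f \<longleftrightarrow> continuous_on X f"
| "Ck_on (Suc k) X f \<longleftrightarrow>
     (\<forall>x\<in>X. f differentiable (at x)) \<and> (\<forall>v. Ck_on k X (\<lambda>x. frechet_derivative f (at x) v))"

definition smooth_on :: "'a::real_normed_vector set \<Rightarrow> ('a \<Rightarrow> 'b::real_normed_vector) \<Rightarrow> bool" where
  "smooth_on X f \<longleftrightarrow> (\<forall>k. Ck_on k X f)"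


section \<open>Smooth spacetimes\<close>

text \<open>
  The underlying point set of the manifold is the whole type \<open>'a\<close>, and its topology is that of the
  type class. The model space \<open>'b\<close> plays the role of the Euclidean space of dimension \<open>DIM('b)\<close>.
  A chart consists of its domain and its coordinate map; values of the map outside the domain
  carry no meaning.
\<close>

type_synonym ('a, 'b) chart = "'a set \<times> ('a \<Rightarrow> 'b)"

abbreviation chart_dom :: "('a, 'b) chart \<Rightarrow> 'a set" where
  "chart_dom \<equiv> fst"

abbreviation chart_map :: "('a, 'b) chart \<Rightarrow> 'a \<Rightarrow> 'b" where
  "chart_map \<equiv> snd"

definition chart_inv :: "('a, 'b) chart \<Rightarrow> 'b \<Rightarrow> 'a" where
  "chart_inv c = inv_into (chart_dom c) (chart_map c)"

definition is_chart :: "('a::topological_space, 'b::euclidean_space) chart \<Rightarrow> bool" where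
  "is_chart c \<longleftrightarrow> open (chart_dom c) \<and> open (chart_map c ` chart_dom c) \<and>
     homeomorphism (chart_dom c) (chart_map c ` chart_dom c) (chart_map c) (chart_inv c)"

definition transition :: "('a, 'b) chart \<Rightarrow> ('a, 'b) chart \<Rightarrow> 'b \<Rightarrow> 'b" where
  "transition c d = chart_map d \<circ> chart_inv c"

definition smooth_atlas :: "('a::topological_space, 'b::euclidean_space) chart set \<Rightarrow> bool" where
  "smooth_atlas C \<longleftrightarrow> (\<forall>c\<in>C. is_chart c) \<and> (\<Union>c\<in>C. chart_dom c) = UNIV \<and>
     (\<forall>c\<in>C. \<forall>d\<in>C. smooth_on (chart_map c ` (chart_dom c \<inter> chart_dom d)) (transition c d))"

text \<open>
  The change of components of a tangent vector at \<open>p\<close> from the chart \<open>c\<close> to the chart \<open>d\<close>.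
\<close>

definition tangent_change ::
    "('a, 'b::euclidean_space) chart \<Rightarrow> ('a, 'b) chart \<Rightarrow> 'a \<Rightarrow> 'b \<Rightarrow> 'b" where
  "tangent_change c d p = frechet_derivative (transition c d) (at (chart_map c p))"

text \<open>
  Tensor fields are given by their components in the charts of the atlas: \<open>metric_tensor S c p u v\<close> is the
  value of the metric at the point \<open>p\<close> on the tangent vectors with components \<open>u\<close> and \<open>v\<close> in the
  chart \<open>c\<close>, and \<open>time_dir S c p\<close> are the components at \<open>p\<close> of the vector field
  representing the time orientation.
\<close>

record ('a, 'b) spacetime =
  charts :: "('a, 'b) chart set"
  metric_tensor :: "('a, 'b) chart \<Rightarrow> 'a \<Rightarrow> 'b \<Rightarrow> 'b \<Rightarrow> real"
  time_dir :: "('a, 'b) chart \<Rightarrow> 'a \<Rightarrow> 'b"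

text \<open>
  A symmetric bilinear form of signature \<open>(-,+,\<dots>,+)\<close>: in the basis given by the images under \<open>L\<close>
  of the standard basis vectors it is \<open>diag(-1,1,\<dots>,1)\<close>, with \<open>-1\<close> in the place of \<open>t\<close>.
\<close>

definition lorentzian_form :: "('b::euclidean_space \<Rightarrow> 'b \<Rightarrow> real) \<Rightarrow> bool" where
  "lorentzian_form B \<longleftrightarrow>
     (\<exists>(L :: 'b \<Rightarrow> 'b) t. linear L \<and> bij L \<and> t \<in> Basis \<and>
        (\<forall>u v. B (L u) (L v) = u \<bullet> v - 2 * (u \<bullet> t) * (v \<bullet> t)))"

definition lorentzian_metric :: "('a::topological_space, 'b::euclidean_space) spacetime \<Rightarrow> bool" where
  "lorentzian_metric S \<longleftrightarrow>
     (\<forall>c\<in>charts S. \<forall>p\<in>chart_dom c. lorentzian_form (metric_tensor S c p)) \<and>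
     (\<forall>c\<in>charts S. \<forall>u v.
        smooth_on (chart_map c ` chart_dom c) (\<lambda>x. metric_tensor S c (chart_inv c x) u v)) \<and>
     (\<forall>c\<in>charts S. \<forall>d\<in>charts S. \<forall>p\<in>chart_dom c \<inter> chart_dom d. \<forall>u v.
        metric_tensor S d p (tangent_change c d p u) (tangent_change c d p v) = metric_tensor S c p u v)"

text \<open>A time orientation is represented by a continuous timelike vector field.\<close>

definition time_orientation :: "('a::topological_space, 'b::euclidean_space) spacetime \<Rightarrow> bool" where
  "time_orientation S \<longleftrightarrow>
     (\<forall>c\<in>charts S. continuous_on (chart_dom c) (time_dir S c)) \<and>
     (\<forall>c\<in>charts S. \<forall>d\<in>charts S. \<forall>p\<in>chart_dom c \<inter> chart_dom d.
        tangent_change c d p (time_dir S c p) = time_dir S d p) \<and>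
     (\<forall>c\<in>charts S. \<forall>p\<in>chart_dom c. metric_tensor S c p (time_dir S c p) (time_dir S c p) < 0)"

definition smooth_spacetime ::
    "('a::{t2_space, second_countable_topology}, 'b::euclidean_space) spacetime \<Rightarrow> bool" where
  "smooth_spacetime S \<longleftrightarrow> connected (UNIV :: 'a set) \<and>
     smooth_atlas (charts S) \<and> lorentzian_metric S \<and> time_orientation S"


section \<open>Causality and chronology\<close>

definition future_timelike :: "('a, 'b) spacetime \<Rightarrow> ('a, 'b) chart \<Rightarrow> 'a \<Rightarrow> 'b \<Rightarrow> bool" where
  "future_timelike S c p v \<longleftrightarrow> metric_tensor S c p v v < 0 \<and> metric_tensor S c p (time_dir S c p) v < 0"

definition future_causal :: "('a, 'b::zero) spacetime \<Rightarrow> ('a, 'b) chart \<Rightarrow> 'a \<Rightarrow> 'b \<Rightarrow> bool" where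
  "future_causal S c p v \<longleftrightarrow>
     v \<noteq> 0 \<and> metric_tensor S c p v v \<le> 0 \<and> metric_tensor S c p (time_dir S c p) v < 0"

text \<open>
  Smoothness of a curve on the closed interval \<open>{a..b}\<close>, endpoints included: near each parameter
  the curve, read in some chart, is the restriction of a smooth map defined on an open interval.
\<close>

definition smooth_curve ::
    "('a, 'b::euclidean_space) spacetime \<Rightarrow> real \<Rightarrow> real \<Rightarrow> (real \<Rightarrow> 'a) \<Rightarrow> bool" where
  "smooth_curve S a b \<gamma> \<longleftrightarrow>
     (\<forall>s\<in>{a..b}. \<exists>c\<in>charts S. \<exists>\<epsilon>>0. \<exists>f. smooth_on (ball s \<epsilon>) f \<and>
        (\<forall>r\<in>{a..b} \<inter> ball s \<epsilon>. \<gamma> r \<in> chart_dom c \<and> chart_map c (\<gamma> r) = f r))"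

text \<open>
  Curves are piecewise smooth. The condition \<open>P\<close> on the velocity is imposed on each smooth piece,
  with one-sided velocities at the ends of the piece.
\<close>

definition piecewise_smooth_curve ::
    "('a, 'b::euclidean_space) spacetime \<Rightarrow> (('a, 'b) chart \<Rightarrow> 'a \<Rightarrow> 'b \<Rightarrow> bool) \<Rightarrow>
       real \<Rightarrow> real \<Rightarrow> (real \<Rightarrow> 'a) \<Rightarrow> bool" where
  "piecewise_smooth_curve S P a b \<gamma> \<longleftrightarrow> a < b \<and>
     (\<exists>(n::nat) t. t 0 = a \<and> t n = b \<and>
        (\<forall>i<n. t i < t (Suc i) \<and> smooth_curve S (t i) (t (Suc i)) \<gamma> \<and>
          (\<forall>s\<in>{t i..t (Suc i)}. \<forall>c\<in>charts S. \<gamma> s \<in> chart_dom c \<longrightarrow>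
            P c (\<gamma> s) (vector_derivative (chart_map c \<circ> \<gamma>) (at s within {t i..t (Suc i)})))))"

definition timelike_curve ::
    "('a, 'b::euclidean_space) spacetime \<Rightarrow> real \<Rightarrow> real \<Rightarrow> (real \<Rightarrow> 'a) \<Rightarrow> bool" where
  "timelike_curve S = piecewise_smooth_curve S (future_timelike S)"

definition causal_curve ::
    "('a, 'b::euclidean_space) spacetime \<Rightarrow> real \<Rightarrow> real \<Rightarrow> (real \<Rightarrow> 'a) \<Rightarrow> bool" where
  "causal_curve S = piecewise_smooth_curve S (future_causal S)"

definition chronology :: "('a, 'b::euclidean_space) spacetime \<Rightarrow> 'a \<Rightarrow> 'a \<Rightarrow> bool" where
  "chronology S x y \<longleftrightarrow> (\<exists>a b \<gamma>. timelike_curve S a b \<gamma> \<and> \<gamma> a = x \<and> \<gamma> b = y)"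

definition causality :: "('a, 'b::euclidean_space) spacetime \<Rightarrow> 'a \<Rightarrow> 'a \<Rightarrow> bool" where
  "causality S x y \<longleftrightarrow> x = y \<or> (\<exists>a b \<gamma>. causal_curve S a b \<gamma> \<and> \<gamma> a = x \<and> \<gamma> b = y)"

text \<open>
  Future and past sets of a relation: for \<open>causality S\<close> these are \<open>J\<^sup>+\<close> and \<open>J\<^sup>-\<close>, for
  \<open>chronology S\<close> they are \<open>I\<^sup>+\<close> and \<open>I\<^sup>-\<close>.
\<close>

definition future_set :: "('a \<Rightarrow> 'a \<Rightarrow> bool) \<Rightarrow> 'a set \<Rightarrow> 'a set" where
  "future_set R A = {y. \<exists>x\<in>A. R x y}"

definition past_set :: "('a \<Rightarrow> 'a \<Rightarrow> bool) \<Rightarrow> 'a set \<Rightarrow> 'a set" where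
  "past_set R A = {x. \<exists>y\<in>A. R x y}"

definition Chron_minus ::
    "('a::topological_space, 'b::euclidean_space) spacetime \<Rightarrow> 'a set \<Rightarrow> 'a set set" where
  "Chron_minus S U = {A. open A \<and> A \<subseteq> past_set (chronology S) U \<and>
     (\<forall>a b \<gamma>. timelike_curve S a b \<gamma> \<and> \<gamma> b \<in> U \<longrightarrow>
        \<gamma> ` {a..b} \<inter> A \<noteq> {} \<or> past_set (chronology S) {\<gamma> a} \<inter> A \<noteq> {})}"


section \<open>Orders on open sets, paths and coverages\<close>

definition egli_milner :: "('a \<Rightarrow> 'a \<Rightarrow> bool) \<Rightarrow> 'a set \<Rightarrow> 'a set \<Rightarrow> bool" where
  "egli_milner R U V \<longleftrightarrow> U \<subseteq> past_set R V \<and> V \<subseteq> future_set R U"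

text \<open>
  In what follows \<open>le\<close> is an order on the open subsets of a space; its values on other sets are
  never used.
\<close>

definition down_cone :: "('a::topological_space set \<Rightarrow> 'a set \<Rightarrow> bool) \<Rightarrow> 'a set \<Rightarrow> 'a set" where
  "down_cone le U = \<Union>{W. open W \<and> le W U}"

text \<open>
  A path is the non-empty list of its steps, \<open>p\<^sub>n\<close> being \<open>p ! n\<close> and the endpoint being \<open>last p\<close>.
\<close>

definition is_path :: "('a::topological_space set \<Rightarrow> 'a set \<Rightarrow> bool) \<Rightarrow> 'a set list \<Rightarrow> bool" where
  "is_path le p \<longleftrightarrow> p \<noteq> [] \<and> (\<forall>n<length p. open (p ! n) \<and> p ! n \<noteq> {}) \<and>
     (\<forall>n. Suc n < length p \<longrightarrow> le (p ! n) (p ! Suc n))"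

definition inhabits :: "'a set list \<Rightarrow> 'a set \<Rightarrow> bool" where
  "inhabits p V \<longleftrightarrow> (\<exists>n<length p. p ! n \<subseteq> V)"

definition lands_in :: "'a set list \<Rightarrow> 'a set \<Rightarrow> bool" where
  "lands_in p V \<longleftrightarrow> last p \<subseteq> V"

definition refines :: "'a set list \<Rightarrow> 'a set list \<Rightarrow> bool" where
  "refines q p \<longleftrightarrow> (\<forall>n<length p. \<exists>m<length q. q ! m \<subseteq> p ! n)"

fun path_restrict ::
    "('a::topological_space set \<Rightarrow> 'a set \<Rightarrow> bool) \<Rightarrow> 'a set list \<Rightarrow> 'a set \<Rightarrow> 'a set list" where
  "path_restrict le [] W = []"
| "path_restrict le [P] W = [W]"
| "path_restrict le (P # P' # ps) W =
     (let r = path_restrict le (P' # ps) W in (P \<inter> down_cone le (hd r)) # r)"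

text \<open>The family of paths is given by the set \<open>Q\<close> of its members.\<close>

definition local_past_refinement ::
    "('a::topological_space set \<Rightarrow> 'a set \<Rightarrow> bool) \<Rightarrow> 'a set list \<Rightarrow> 'a set list set \<Rightarrow> bool" where
  "local_past_refinement le p Q \<longleftrightarrow> (\<forall>q\<in>Q. is_path le q) \<and> (\<Union>q\<in>Q. last q) = last p \<and>
     (\<forall>q\<in>Q. refines q (path_restrict le p (last q)))"

definition Cov_minus :: "('a::topological_space set \<Rightarrow> 'a set \<Rightarrow> bool) \<Rightarrow> 'a set \<Rightarrow> 'a set set" where
  "Cov_minus le U = {A. open A \<and> A \<subseteq> down_cone le U \<and>
     (\<forall>p. is_path le p \<and> lands_in p U \<longrightarrow>
        (\<exists>Q. local_past_refinement le p Q \<and> (\<forall>q\<in>Q. inhabits q A)))}"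

end

theory Submission
  imports Defs
begin

text \<open>
  Moving an end point of a timelike curve slightly keeps it timelike, so chronological pasts and
  futures are open. A causal curve is pushed into a timelike one by adding a small multiple of
  \<open>(s - v) T\<close> to it in a chart, where \<open>T\<close> is a timelike vector and \<open>v\<close> the end of a short parameter
  interval: the gain in the velocity is of first order, while the change of the (locally Lipschitz)
  metric costs only a small fraction of it. Hence \<open>x \<preceq> y\<close> puts \<open>x\<close> in the closure of \<open>I\<^sup>-(y)\<close>.

  For a point \<open>x\<close> in the endpoint of a path, one therefore finds points \<open>x\<^sub>0 \<lless> \<dots> \<lless> x\<^sub>N = x\<close> in the
  steps. A timelike curve through all of them which starts at a point before \<open>x\<^sub>0\<close> yields a point of \<open>A\<close>
  that lies in this chain or can be inserted into it. With \<open>V(z)\<close> the intersection of \<open>A\<close> and the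
  steps, as far as these contain \<open>z\<close>, the sets \<open>V(z\<^sub>i) \<inter> I\<^sup>+(z\<^sub>i\<^sub>-\<^sub>1) \<inter> I\<^sup>-(z\<^sub>i\<^sub>+\<^sub>1)\<close> form the
  refining path.
\<close>

section \<open>Smooth maps\<close>

lemma Ck_on_subset: "Ck_on k X f \<Longrightarrow> Y \<subseteq> X \<Longrightarrow> Ck_on k Y f"
  by (induction k arbitrary: f) (auto intro: continuous_on_subset)

text \<open>Since \<open>frechet_derivative\<close> is a choice among all derivatives at the point,
  it suffices that both functions have the same derivatives there; no differentiability has to be
  assumed.\<close>

lemma frechet_derivative_cong_open:
  assumes "open X" "x \<in> X" "\<And>y. y \<in> X \<Longrightarrow> f y = g y"
  shows "frechet_derivative f (at x) = frechet_derivative g (at x)"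
proof -
  have "(f has_derivative D) (at x) \<longleftrightarrow> (g has_derivative D) (at x)" for D
    using assms has_derivative_transform_within_open[of _ D x UNIV X] by metis
  then show ?thesis
    by (simp add: frechet_derivative_def)
qed

text \<open>On an open set the agreement of two functions passes to their derivatives, so the
  induction hypothesis applies to these. This is what allows an explicit formula for a derivative to
  be substituted under \<open>Ck_on\<close>.\<close>

lemma Ck_on_cong:
  assumes "open X" "\<And>x. x \<in> X \<Longrightarrow> f x = g x" "Ck_on k X f"
  shows "Ck_on k X g"
  using assms(2,3)
proof (induction k arbitrary: f g)
  case 0
  then show ?case
    using continuous_on_cong[of X X f g] by simp
next
  case (Suc k)
  have "g differentiable (at x)" if "x \<in> X" for x
    using Suc.prems that assms(1) unfolding Ck_on.simps differentiable_def
    using has_derivative_transform_within_open[of f _ x UNIV X g] by metis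
  moreover have "Ck_on k X (\<lambda>x. frechet_derivative g (at x) v)" for v
  proof (rule Suc.IH[of "\<lambda>x. frechet_derivative f (at x) v"])
    show "frechet_derivative f (at x) v = frechet_derivative g (at x) v" if "x \<in> X" for x
      using frechet_derivative_cong_open[OF assms(1) that Suc.prems(1)] by simp
    show "Ck_on k X (\<lambda>x. frechet_derivative f (at x) v)"
      using Suc.prems(2) by simp
  qed
  ultimately show ?case
    by simp
qed

lemma Ck_on_add:
  assumes "open X" "Ck_on k X f" "Ck_on k X g"
  shows "Ck_on k X (\<lambda>x. f x + g x)"
  using assms(2,3)
proof (induction k arbitrary: f g)
  case 0
  then show ?case
    by (auto intro: continuous_on_add)
next
  case (Suc k)
  have "frechet_derivative (\<lambda>x. f x + g x) (at x)
      = (\<lambda>v. frechet_derivative f (at x) v + frechet_derivative g (at x) v)" if "x \<in> X" for x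
  proof -
    have "f differentiable (at x)" "g differentiable (at x)"
      using Suc.prems that by simp_all
    then have "(f has_derivative frechet_derivative f (at x)) (at x)"
      "(g has_derivative frechet_derivative g (at x)) (at x)"
      using frechet_derivative_works by blast+
    from has_derivative_add[OF this] show ?thesis
      by (rule frechet_derivative_at[symmetric])
  qed
  note that = this
  have "Ck_on k X (\<lambda>x. frechet_derivative (\<lambda>x. f x + g x) (at x) v)" for v
  proof (rule Ck_on_cong[OF assms(1), of "\<lambda>x. frechet_derivative f (at x) v + frechet_derivative g (at x) v"])
    show "Ck_on k X (\<lambda>x. frechet_derivative f (at x) v + frechet_derivative g (at x) v)"
      using Suc.IH[of "\<lambda>x. frechet_derivative f (at x) v" "\<lambda>x. frechet_derivative g (at x) v"] Suc.prems
      by simp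
  qed (simp add: that)
  then show ?case
    using Suc.prems by (simp add: differentiable_add)
qed

lemma Ck_on_const: "Ck_on k X (\<lambda>x. c)"
  by (induction k arbitrary: c) auto

text \<open>The derivative does not depend on the point, so all higher orders reduce to constant
  functions and a case distinction on \<open>k\<close> replaces an induction. Straight lines and the
  perturbation of causal curves are of this form.\<close>

lemma smooth_on_affine: "smooth_on X (\<lambda>s::real. v + s *\<^sub>R w)"
proof -
  have "((\<lambda>s::real. v + s *\<^sub>R w) has_derivative (\<lambda>h. h *\<^sub>R w)) (at x)" for x
    by (auto intro!: derivative_eq_intros)
  then have "frechet_derivative (\<lambda>s::real. v + s *\<^sub>R w) (at x) = (\<lambda>h. h *\<^sub>R w)"
    "(\<lambda>s::real. v + s *\<^sub>R w) differentiable (at x)" for x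
    using frechet_derivative_at by (metis, metis differentiableI)
  then have "Ck_on k X (\<lambda>s::real. v + s *\<^sub>R w)" for k
    by (cases k) (auto intro!: continuous_intros Ck_on_const)
  then show ?thesis
    by (simp add: smooth_on_def)
qed

text \<open>Having an equivalence for every candidate \<open>D\<close> makes the chosen values
  \<open>frechet_derivative\<close> and \<open>vector_derivative\<close> of both functions equal,
  even before differentiability is known.\<close>

lemma has_derivative_shift:
  fixes f :: "'a::real_normed_vector \<Rightarrow> 'b::real_normed_vector"
  shows "((\<lambda>x. f (x - c)) has_derivative D) (at x within (\<lambda>y. y + c) ` A)
    \<longleftrightarrow> (f has_derivative D) (at (x - c) within A)"
proof
  assume *: "((\<lambda>x. f (x - c)) has_derivative D) (at x within (\<lambda>y. y + c) ` A)"
  have "((\<lambda>y. y + c) has_derivative (\<lambda>h. h)) (at (x - c) within A)"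
    by (auto intro!: derivative_eq_intros)
  from has_derivative_in_compose[OF this, of "\<lambda>x. f (x - c)" D] *
  show "(f has_derivative D) (at (x - c) within A)"
    by simp
next
  assume *: "(f has_derivative D) (at (x - c) within A)"
  have "((\<lambda>y. y - c) has_derivative (\<lambda>h. h)) (at x within (\<lambda>y. y + c) ` A)"
    by (auto intro!: derivative_eq_intros)
  from has_derivative_in_compose[OF this, of f D] *
  show "((\<lambda>x. f (x - c)) has_derivative D) (at x within (\<lambda>y. y + c) ` A)"
    by (simp add: image_image)
qed

lemma Ck_on_shift: "Ck_on k X f \<Longrightarrow> Ck_on k ((\<lambda>y. y + c) ` X) (\<lambda>x. f (x - c))"
proof (induction k arbitrary: f)
  case 0
  then show ?case
    by (auto intro!: continuous_on_compose2[of X f _ "\<lambda>x. x - c"] continuous_on_diff continuous_on_id continuous_on_const)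
next
  case (Suc k)
  have *: "((\<lambda>x. f (x - c)) has_derivative D) (at x) \<longleftrightarrow> (f has_derivative D) (at (x - c))" for D x
    using has_derivative_shift[of f c D x UNIV] by (simp add: surj_plus_right)
  then have "frechet_derivative (\<lambda>x. f (x - c)) (at x) = frechet_derivative f (at (x - c))" for x
    by (simp add: frechet_derivative_def)
  moreover have "Ck_on k ((\<lambda>y. y + c) ` X) (\<lambda>x. frechet_derivative f (at (x - c)) v)" for v
    using Suc.prems by (intro Suc.IH[of "\<lambda>x. frechet_derivative f (at x) v"]) simp
  ultimately show ?case
    using Suc.prems * by (auto simp: differentiable_def)
qed

lemma smooth_on_subset: "smooth_on X f \<Longrightarrow> Y \<subseteq> X \<Longrightarrow> smooth_on Y f"
  by (auto simp: smooth_on_def intro: Ck_on_subset)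

lemma smooth_on_add: "open X \<Longrightarrow> smooth_on X f \<Longrightarrow> smooth_on X g \<Longrightarrow> smooth_on X (\<lambda>x. f x + g x)"
  by (auto simp: smooth_on_def intro: Ck_on_add)

lemma smooth_on_shift: "smooth_on X f \<Longrightarrow> smooth_on ((\<lambda>y. y + c) ` X) (\<lambda>x. f (x - c))"
  by (auto simp: smooth_on_def intro: Ck_on_shift)

section \<open>Continuity, derivatives and Lipschitz bounds of smooth maps\<close>

lemma smooth_on_differentiable: "smooth_on X f \<Longrightarrow> x \<in> X \<Longrightarrow> f differentiable (at x)"
  using Ck_on.simps(2)[of 0 X f] by (auto simp: smooth_on_def simp del: Ck_on.simps)

lemma smooth_on_frechet_continuous:
  "smooth_on X f \<Longrightarrow> continuous_on X (\<lambda>x. frechet_derivative f (at x) v)"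
  using Ck_on.simps(2)[of 0 X f] by (auto simp: smooth_on_def simp del: Ck_on.simps(2))

lemma smooth_on_continuous: "smooth_on X f \<Longrightarrow> continuous_on X f"
  unfolding smooth_on_def by (metis Ck_on.simps(1))

lemma smooth_on_has_vector_derivative:
  "smooth_on X f \<Longrightarrow> x \<in> X \<Longrightarrow> (f has_vector_derivative vector_derivative f (at x)) (at x)"
  using smooth_on_differentiable vector_derivative_works by blast

lemma smooth_on_vector_derivative_continuous:
  assumes "smooth_on X f"
  shows "continuous_on X (\<lambda>x. vector_derivative f (at x))"
proof -
  have "frechet_derivative f (at x) 1 = vector_derivative f (at x)" if "x \<in> X" for x
    using smooth_on_has_vector_derivative[OF assms that]
    by (metis frechet_derivative_at has_vector_derivative_def scaleR_one)
  then show ?thesis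
    using smooth_on_frechet_continuous[OF assms, of 1] continuous_on_cong by force
qed

text \<open>The partial derivatives are continuous, hence bounded on a compact ball. By linearity
  the sum of these bounds dominates the operator norm of the derivative, and the mean value
  inequality on the convex ball gives the constant.\<close>

lemma smooth_on_locally_Lipschitz:
  fixes f :: "'a::euclidean_space \<Rightarrow> real"
  assumes "open X" "smooth_on X f" "x0 \<in> X"
  shows "\<exists>r>0. \<exists>L\<ge>0. ball x0 r \<subseteq> X \<and> (\<forall>x\<in>ball x0 r. \<forall>y\<in>ball x0 r. \<bar>f y - f x\<bar> \<le> L * norm (y - x))"
proof -
  obtain r where r: "r > 0" "cball x0 r \<subseteq> X"
    using assms open_contains_cball by blast
  define D where "D x = frechet_derivative f (at x)" for x
  have D: "(f has_derivative D x) (at x)" if "x \<in> X" for x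
    using smooth_on_differentiable[OF assms(2) that] by (simp add: D_def frechet_derivative_works)
  have "\<exists>B. \<forall>x\<in>cball x0 r. \<bar>D x i\<bar> \<le> B" for i
  proof -
    have "compact ((\<lambda>x. D x i) ` cball x0 r)"
      using smooth_on_frechet_continuous[OF assms(2)] r(2) unfolding D_def
      by (intro compact_continuous_image) (auto intro: continuous_on_subset)
    then show ?thesis
      by (auto dest!: compact_imp_bounded simp: bounded_iff)
  qed
  then obtain B where B: "\<And>i x. x \<in> cball x0 r \<Longrightarrow> \<bar>D x i\<bar> \<le> B i"
    by metis
  define L where "L = (\<Sum>i\<in>Basis. B i)"
  have B0: "B i \<ge> 0" for i
    using B[of x0 i] r(1) by auto
  have "onorm (D x) \<le> L" if x: "x \<in> cball x0 r" for x
  proof (rule onorm_bound)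
    show "0 \<le> L"
      by (simp add: L_def sum_nonneg B0)
    fix v
    have lin: "linear (D x)"
      using D[of x] r x has_derivative_linear by blast
    have "D x v = (\<Sum>i\<in>Basis. (v \<bullet> i) * D x i)"
      using linear_sum[OF lin, of "\<lambda>i. (v \<bullet> i) *\<^sub>R i" Basis] linear_cmul[OF lin]
      by (simp add: euclidean_representation)
    also have "norm \<dots> \<le> (\<Sum>i\<in>Basis. norm v * B i)"
      using B[OF x] Basis_le_norm[of _ v]
      by (intro sum_norm_le) (auto simp: abs_mult intro!: mult_mono)
    finally show "norm (D x v) \<le> L * norm v"
      by (simp add: L_def sum_distrib_left mult.commute)
  qed
  then have "norm (f y - f x) \<le> L * norm (y - x)" if "x \<in> ball x0 r" "y \<in> ball x0 r" for x y
    using that D r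
    by (intro differentiable_bound[of "ball x0 r" f D L])
       (auto intro: has_derivative_at_withinI simp: subset_iff)
  then show ?thesis
    using r B0 by (intro exI[of _ r] conjI exI[of _ L]) (auto simp: L_def sum_nonneg subset_iff)
qed

section \<open>Curves\<close>

text \<open>This isolates what \<open>piecewise_smooth_curve\<close> demands of a single piece, so
  that pieces can be cut, moved and joined without reference to a subdivision.\<close>

definition curve_segment ::
    "('a, 'b::euclidean_space) spacetime \<Rightarrow> (('a, 'b) chart \<Rightarrow> 'a \<Rightarrow> 'b \<Rightarrow> bool) \<Rightarrow>
       real \<Rightarrow> real \<Rightarrow> (real \<Rightarrow> 'a) \<Rightarrow> bool" where
  "curve_segment S P a b \<gamma> \<longleftrightarrow> a < b \<and> smooth_curve S a b \<gamma> \<and>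
     (\<forall>s\<in>{a..b}. \<forall>c\<in>charts S. \<gamma> s \<in> chart_dom c \<longrightarrow>
        P c (\<gamma> s) (vector_derivative (chart_map c \<circ> \<gamma>) (at s within {a..b})))"

lemma smooth_curve_cong:
  assumes "\<And>s. s \<in> {a..b} \<Longrightarrow> \<gamma> s = \<gamma>' s" "smooth_curve S a b \<gamma>"
  shows "smooth_curve S a b \<gamma>'"
  using assms unfolding smooth_curve_def by (metis IntD1)

lemma smooth_curveE:
  assumes "smooth_curve S a b \<gamma>" "s \<in> {a..b}"
  obtains c \<epsilon> f where "c \<in> charts S" "\<epsilon> > 0" "smooth_on (ball s \<epsilon>) f"
    "\<And>r. r \<in> {a..b} \<Longrightarrow> dist r s < \<epsilon> \<Longrightarrow> \<gamma> r \<in> chart_dom c"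
    "\<And>r. r \<in> {a..b} \<Longrightarrow> dist r s < \<epsilon> \<Longrightarrow> chart_map c (\<gamma> r) = f r"
  using assms unfolding smooth_curve_def by (metis Int_iff dist_commute mem_ball)

text \<open>The derivative within \<open>{a..b}\<close> sees only values on that interval. Hence a
  concatenated curve, which agrees with a given curve only there, inherits its pieces.\<close>

lemma curve_segment_cong:
  assumes eq: "\<And>s. s \<in> {a..b} \<Longrightarrow> \<gamma> s = \<gamma>' s" and seg: "curve_segment S P a b \<gamma>"
  shows "curve_segment S P a b \<gamma>'"
proof -
  have "vector_derivative (chart_map c \<circ> \<gamma>) (at s within {a..b})
      = vector_derivative (chart_map c \<circ> \<gamma>') (at s within {a..b})" if "s \<in> {a..b}" for c :: "('a, 'b) chart" and s
    using eq that by (intro vector_derivative_cong_eq eventually_at_filter[THEN iffD2] always_eventually) auto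
  then show ?thesis
    using seg eq smooth_curve_cong[OF eq] unfolding curve_segment_def by auto
qed

lemma smooth_curve_shift:
  assumes "smooth_curve S a b \<gamma>"
  shows "smooth_curve S (a + k) (b + k) (\<lambda>s. \<gamma> (s - k))"
  unfolding smooth_curve_def
proof
  fix s assume "s \<in> {a + k..b + k}"
  then have "s - k \<in> {a..b}"
    by auto
  then obtain c \<epsilon> f where c: "c \<in> charts S" "\<epsilon> > 0" "smooth_on (ball (s - k) \<epsilon>) f"
    and f: "\<And>r. r \<in> {a..b} \<inter> ball (s - k) \<epsilon> \<Longrightarrow> \<gamma> r \<in> chart_dom c \<and> chart_map c (\<gamma> r) = f r"
    using assms unfolding smooth_curve_def by blast
  have "ball s \<epsilon> = (\<lambda>y. y + k) ` ball (s - k) \<epsilon>"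
  proof (intro set_eqI iffI)
    fix r assume "r \<in> ball s \<epsilon>"
    then show "r \<in> (\<lambda>y. y + k) ` ball (s - k) \<epsilon>"
      by (intro image_eqI[of _ _ "r - k"]) (auto simp: dist_real_def)
  qed (auto simp: dist_real_def)
  then have "smooth_on (ball s \<epsilon>) (\<lambda>x. f (x - k))"
    using smooth_on_shift[OF c(3), of k] by simp
  moreover have "\<gamma> (r - k) \<in> chart_dom c \<and> chart_map c (\<gamma> (r - k)) = f (r - k)"
    if "r \<in> {a + k..b + k} \<inter> ball s \<epsilon>" for r
    using that by (intro f) (auto simp: dist_real_def)
  ultimately show "\<exists>c\<in>charts S. \<exists>\<epsilon>>0. \<exists>f. smooth_on (ball s \<epsilon>) f \<and>
      (\<forall>r\<in>{a + k..b + k} \<inter> ball s \<epsilon>. \<gamma> (r - k) \<in> chart_dom c \<and> chart_map c (\<gamma> (r - k)) = f r)"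
    using c by blast
qed

text \<open>A translation of the parameter leaves velocities unchanged. It serves to fit together
  curves whose parameter intervals do not match.\<close>

lemma curve_segment_shift:
  assumes "curve_segment S P a b \<gamma>"
  shows "curve_segment S P (a + k) (b + k) (\<lambda>s. \<gamma> (s - k))"
proof -
  have image: "(\<lambda>y. y + k) ` {a..b} = {a + k..b + k}"
    by (simp add: image_add_atLeastAtMost')
  have "vector_derivative (chart_map c \<circ> (\<lambda>s. \<gamma> (s - k))) (at s within {a + k..b + k})
      = vector_derivative (chart_map c \<circ> \<gamma>) (at (s - k) within {a..b})" for c :: "('a, 'b) chart" and s
    using has_derivative_shift[of "chart_map c \<circ> \<gamma>" k _ s "{a..b}"]
    unfolding image by (simp add: vector_derivative_def has_vector_derivative_def o_def)
  then show ?thesis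
    using assms smooth_curve_shift[of S a b \<gamma> k] unfolding curve_segment_def by auto
qed

text \<open>The subdivision is hidden in an inductive predicate that peels off the first piece,
  which turns statements about piecewise smooth curves into rule inductions.\<close>

inductive curve_chain ::
    "('a, 'b::euclidean_space) spacetime \<Rightarrow> (('a, 'b) chart \<Rightarrow> 'a \<Rightarrow> 'b \<Rightarrow> bool) \<Rightarrow>
       (real \<Rightarrow> 'a) \<Rightarrow> real \<Rightarrow> real \<Rightarrow> bool" for S P \<gamma> where
  single: "curve_segment S P a b \<gamma> \<Longrightarrow> curve_chain S P \<gamma> a b"
| step: "curve_segment S P a b \<gamma> \<Longrightarrow> curve_chain S P \<gamma> b c \<Longrightarrow> curve_chain S P \<gamma> a c"

lemma piecewise_smooth_curve_iff_segments:
  "piecewise_smooth_curve S P a b \<gamma> \<longleftrightarrow> a < b \<and>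
    (\<exists>n t. t 0 = a \<and> t n = b \<and> (\<forall>i<n. curve_segment S P (t i) (t (Suc i)) \<gamma>))"
  by (simp add: piecewise_smooth_curve_def curve_segment_def)

lemma piecewise_smooth_curve_iff_chain:
  "piecewise_smooth_curve S P a b \<gamma> \<longleftrightarrow> curve_chain S P \<gamma> a b"
proof
  have "curve_chain S P \<gamma> (t 0) (t (Suc n))"
    if "\<And>i. i < Suc n \<Longrightarrow> curve_segment S P (t i) (t (Suc i)) \<gamma>" for n and t :: "nat \<Rightarrow> real"
    using that
  proof (induction n arbitrary: t)
    case 0
    then show ?case
      by (simp add: curve_chain.single)
  next
    case (Suc n)
    show ?case
      using Suc.IH[of "\<lambda>i. t (Suc i)"] Suc.prems by (intro curve_chain.step[of S P "t 0" "t 1"]) auto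
  qed
  note chain = this
  assume "piecewise_smooth_curve S P a b \<gamma>"
  then obtain n t where "a < b"
    and t: "t 0 = a" "t n = b" "\<And>i. i < n \<Longrightarrow> curve_segment S P (t i) (t (Suc i)) \<gamma>"
    unfolding piecewise_smooth_curve_iff_segments by blast
  \<comment> \<open>Without any piece both end points would coincide.\<close>
  moreover from this have "n \<noteq> 0"
    by (cases n) auto
  ultimately show "curve_chain S P \<gamma> a b"
    using chain[of "n - 1" t] by simp
next
  assume "curve_chain S P \<gamma> a b"
  then have "a < b \<and> (\<exists>n t. t 0 = a \<and> t n = b \<and> (\<forall>i<n. curve_segment S P (t i) (t (Suc i)) \<gamma>))"
  proof induction
    case (single a b)
    then have "a < b"
      by (simp add: curve_segment_def)
    let ?t = "\<lambda>i::nat. if i = 0 then a else b"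
    show ?case
      using single \<open>a < b\<close> by (intro conjI exI[of _ 1] exI[of _ ?t]) simp_all
  next
    case (step a b c)
    obtain n t where t: "t 0 = b" "t n = c" "\<forall>i<n. curve_segment S P (t i) (t (Suc i)) \<gamma>"
      using step.IH by (elim conjE exE)
    \<comment> \<open>The new first node is put in front, moving all others up by one index.\<close>
    let ?t = "case_nat a t"
    have "curve_segment S P (?t i) (?t (Suc i)) \<gamma>" if "i < Suc n" for i
      using t step.hyps(1) that by (cases i) auto
    moreover have "a < c"
      using step by (simp add: curve_segment_def)
    ultimately show ?case
      using t(2) by (intro conjI exI[of _ "Suc n"] exI[of _ ?t]) simp_all
  qed
  then show "piecewise_smooth_curve S P a b \<gamma>"
    by (simp add: piecewise_smooth_curve_iff_segments)
qed

lemma curve_chain_less: "curve_chain S P \<gamma> a b \<Longrightarrow> a < b"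
  by (induction rule: curve_chain.induct) (auto simp: curve_segment_def)

lemma curve_chain_append: "curve_chain S P \<gamma> a b \<Longrightarrow> curve_chain S P \<gamma> b c \<Longrightarrow> curve_chain S P \<gamma> a c"
  by (induction rule: curve_chain.induct) (auto intro: curve_chain.intros)

lemma curve_chain_cong:
  "curve_chain S P \<gamma> a b \<Longrightarrow> (\<And>s. s \<in> {a..b} \<Longrightarrow> \<gamma> s = \<gamma>' s) \<Longrightarrow> curve_chain S P \<gamma>' a b"
proof (induction rule: curve_chain.induct)
  case (single a b)
  then show ?case
    by (metis curve_chain.single curve_segment_cong)
next
  case (step a b c)
  have "a < b" "b < c"
    using step.hyps curve_chain_less by (auto simp: curve_segment_def)
  with step show ?case
    by (intro curve_chain.step[of S P a b] curve_segment_cong[of a b \<gamma> \<gamma>']) auto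
qed

lemma curve_chain_shift:
  "curve_chain S P \<gamma> a b \<Longrightarrow> curve_chain S P (\<lambda>s. \<gamma> (s - k)) (a + k) (b + k)"
  by (induction rule: curve_chain.induct) (auto intro: curve_chain.intros curve_segment_shift)

text \<open>The second curve is translated so as to start where the first one stops. The bound on
  the image is kept because the position of the points on a concatenated curve matters when the
  covering condition is applied to it.\<close>

lemma curve_chain_join:
  assumes "curve_chain S P \<gamma> a b" "curve_chain S P \<gamma>' a' b'" "\<gamma> b = \<gamma>' a'"
  shows "\<exists>\<gamma>'' c. curve_chain S P \<gamma>'' a c \<and> \<gamma>'' a = \<gamma> a \<and> \<gamma>'' c = \<gamma>' b' \<and>
    \<gamma>'' ` {a..c} \<subseteq> \<gamma> ` {a..b} \<union> \<gamma>' ` {a'..b'}"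
proof -
  define \<gamma>'' where "\<gamma>'' s = (if s \<le> b then \<gamma> s else \<gamma>' (s - (b - a')))" for s
  define c where "c = b' + (b - a')"
  have less: "a < b" "a' < b'"
    using assms(1,2) by (auto intro: curve_chain_less)
  have "curve_chain S P \<gamma>'' a b"
    using assms(1) by (rule curve_chain_cong) (simp add: \<gamma>''_def)
  moreover have "curve_chain S P (\<lambda>s. \<gamma>' (s - (b - a'))) b c"
    using curve_chain_shift[OF assms(2), of "b - a'"] by (simp add: c_def)
  then have "curve_chain S P \<gamma>'' b c"
    by (rule curve_chain_cong) (use assms(3) in \<open>auto simp: \<gamma>''_def\<close>)
  ultimately have "curve_chain S P \<gamma>'' a c"
    by (rule curve_chain_append)
  moreover have "\<gamma>'' ` {a..c} \<subseteq> \<gamma> ` {a..b} \<union> \<gamma>' ` {a'..b'}"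
    by (auto simp: \<gamma>''_def c_def)
  moreover have "\<gamma>'' a = \<gamma> a" "\<gamma>'' c = \<gamma>' b'"
    using less by (auto simp: \<gamma>''_def c_def)
  ultimately show ?thesis
    by blast
qed

lemma chronology_iff_chain: "chronology S x y \<longleftrightarrow> (\<exists>a b \<gamma>. curve_chain S (future_timelike S) \<gamma> a b \<and> \<gamma> a = x \<and> \<gamma> b = y)"
  by (simp add: chronology_def timelike_curve_def piecewise_smooth_curve_iff_chain)

lemma causality_iff_chain:
  "causality S x y \<longleftrightarrow> x = y \<or> (\<exists>a b \<gamma>. curve_chain S (future_causal S) \<gamma> a b \<and> \<gamma> a = x \<and> \<gamma> b = y)"
  by (simp add: causality_def causal_curve_def piecewise_smooth_curve_iff_chain)

lemma chronology_trans: "chronology S x y \<Longrightarrow> chronology S y z \<Longrightarrow> chronology S x z"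
proof -
  assume "chronology S x y" "chronology S y z"
  then obtain a b \<gamma> a' b' \<gamma>' where "curve_chain S (future_timelike S) \<gamma> a b" "\<gamma> a = x" "\<gamma> b = y"
    "curve_chain S (future_timelike S) \<gamma>' a' b'" "\<gamma>' a' = y" "\<gamma>' b' = z"
    unfolding chronology_iff_chain by metis
  then show ?thesis
    using curve_chain_join[of S "future_timelike S" \<gamma> a b \<gamma>' a' b'] unfolding chronology_iff_chain by metis
qed

section \<open>Charts, changes of coordinates and the cutting of curves\<close>

locale spacetime_manifold =
  fixes S :: "('a::{t2_space, second_countable_topology}, 'b::euclidean_space) spacetime"
  assumes S: "smooth_spacetime S"
begin

abbreviation chart_range :: "('a, 'b) chart \<Rightarrow> 'b set" where
  "chart_range c \<equiv> chart_map c ` chart_dom c"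

lemma is_chart: "c \<in> charts S \<Longrightarrow> is_chart c"
  using S by (simp add: smooth_spacetime_def smooth_atlas_def)

lemma open_dom: "c \<in> charts S \<Longrightarrow> open (chart_dom c)"
  and open_range: "c \<in> charts S \<Longrightarrow> open (chart_range c)"
  and continuous_chart_map: "c \<in> charts S \<Longrightarrow> continuous_on (chart_dom c) (chart_map c)"
  and continuous_chart_inv: "c \<in> charts S \<Longrightarrow> continuous_on (chart_range c) (chart_inv c)"
  and chart_inv_map [simp]: "c \<in> charts S \<Longrightarrow> p \<in> chart_dom c \<Longrightarrow> chart_inv c (chart_map c p) = p"
  and chart_map_inv [simp]: "c \<in> charts S \<Longrightarrow> x \<in> chart_range c \<Longrightarrow> chart_map c (chart_inv c x) = x"
  and chart_inv_in_dom [simp]: "c \<in> charts S \<Longrightarrow> x \<in> chart_range c \<Longrightarrow> chart_inv c x \<in> chart_dom c"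
  using is_chart[of c] by (auto simp: is_chart_def homeomorphism_def)

lemma chart_exists: "\<exists>c\<in>charts S. p \<in> chart_dom c"
  using S by (auto simp: smooth_spacetime_def smooth_atlas_def)

lemma transition_has_derivative:
  assumes "c \<in> charts S" "d \<in> charts S" "p \<in> chart_dom c" "p \<in> chart_dom d"
  shows "(transition c d has_derivative tangent_change c d p) (at (chart_map c p))"
proof -
  have "smooth_on (chart_map c ` (chart_dom c \<inter> chart_dom d)) (transition c d)"
    using S assms by (simp add: smooth_spacetime_def smooth_atlas_def)
  from smooth_on_differentiable[OF this, of "chart_map c p"] show ?thesis
    using assms by (simp add: tangent_change_def frechet_derivative_works)
qed

lemma linear_tangent_change:
  assumes "c \<in> charts S" "d \<in> charts S" "p \<in> chart_dom c" "p \<in> chart_dom d"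
  shows "linear (tangent_change c d p)"
  using transition_has_derivative[OF assms] by (rule has_derivative_linear)

text \<open>This is the chain rule for the transition map. The curve has to stay in the domain of
  \<open>c\<close> near \<open>s\<close>, since only there does the composition with the transition
  map reproduce the curve read in \<open>d\<close>.\<close>

lemma chart_change_has_vector_derivative:
  assumes cd: "c \<in> charts S" "d \<in> charts S" and s: "s \<in> I" "\<gamma> s \<in> chart_dom d"
    and near: "e > 0" "\<And>r. r \<in> I \<Longrightarrow> dist r s < e \<Longrightarrow> \<gamma> r \<in> chart_dom c"
    and v: "(chart_map c \<circ> \<gamma> has_vector_derivative v) (at s within I)"
  shows "(chart_map d \<circ> \<gamma> has_vector_derivative tangent_change c d (\<gamma> s) v) (at s within I)"
proof -
  have c: "\<gamma> s \<in> chart_dom c"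
    using near s by simp
  have "((transition c d \<circ> (chart_map c \<circ> \<gamma>)) has_derivative
      (tangent_change c d (\<gamma> s) \<circ> (\<lambda>x. x *\<^sub>R v))) (at s within I)"
    using v transition_has_derivative[OF cd c s(2)]
    by (intro diff_chain_within) (auto simp: has_vector_derivative_def intro: has_derivative_at_withinI)
  then have "((transition c d \<circ> (chart_map c \<circ> \<gamma>)) has_vector_derivative tangent_change c d (\<gamma> s) v)
      (at s within I)"
    using linear_cmul[OF linear_tangent_change[OF cd c s(2)]]
    by (simp add: has_vector_derivative_def o_def)
  then show ?thesis
    by (rule has_vector_derivative_transform_within[OF _ near(1) s(1)])
       (use near(2) cd in \<open>auto simp: transition_def\<close>)
qed

text \<open>Smoothness provides one suitable chart near \<open>s\<close>, and a change of
  coordinates carries the derivative to every other chart around the point. Thus the velocities in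
  the definition of a curve are genuine derivatives and not arbitrary choices.\<close>

lemma smooth_curve_has_vector_derivative:
  assumes \<gamma>: "smooth_curve S a b \<gamma>" and s: "s \<in> {a..b}" and d: "d \<in> charts S" "\<gamma> s \<in> chart_dom d"
  shows "(chart_map d \<circ> \<gamma> has_vector_derivative
    vector_derivative (chart_map d \<circ> \<gamma>) (at s within {a..b})) (at s within {a..b})"
proof -
  obtain c \<epsilon> f where c: "c \<in> charts S" "\<epsilon> > 0" "smooth_on (ball s \<epsilon>) f"
    and f: "\<And>r. r \<in> {a..b} \<Longrightarrow> dist r s < \<epsilon> \<Longrightarrow> \<gamma> r \<in> chart_dom c"
      "\<And>r. r \<in> {a..b} \<Longrightarrow> dist r s < \<epsilon> \<Longrightarrow> chart_map c (\<gamma> r) = f r"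
    using smooth_curveE[OF \<gamma> s] by metis
  have "(f has_vector_derivative vector_derivative f (at s)) (at s within {a..b})"
    using smooth_on_has_vector_derivative[OF c(3), of s] c(2)
    by (auto intro: has_vector_derivative_at_within)
  then have "(chart_map c \<circ> \<gamma> has_vector_derivative vector_derivative f (at s)) (at s within {a..b})"
    by (rule has_vector_derivative_transform_within[OF _ c(2) s]) (use f in auto)
  from chart_change_has_vector_derivative[OF c(1) d(1) s d(2) c(2) _ this] show ?thesis
    using f by (metis differentiableI_vector vector_derivative_works)
qed

lemma smooth_curve_mono:
  assumes "smooth_curve S a b \<gamma>" "a \<le> a'" "b' \<le> b"
  shows "smooth_curve S a' b' \<gamma>"
  unfolding smooth_curve_def
proof
  fix s assume "s \<in> {a'..b'}"
  then have "s \<in> {a..b}"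
    using assms by auto
  moreover have "{a'..b'} \<inter> ball s \<epsilon> \<subseteq> {a..b} \<inter> ball s \<epsilon>" for \<epsilon>
    using assms by auto
  ultimately show "\<exists>c\<in>charts S. \<exists>\<epsilon>>0. \<exists>f. smooth_on (ball s \<epsilon>) f \<and>
      (\<forall>r\<in>{a'..b'} \<inter> ball s \<epsilon>. \<gamma> r \<in> chart_dom c \<and> chart_map c (\<gamma> r) = f r)"
    using assms(1) unfolding smooth_curve_def by (meson subsetD)
qed

text \<open>A genuine derivative remains one within a smaller interval, and there it is unique
  because the interval is nondegenerate.\<close>

lemma curve_segment_mono:
  assumes seg: "curve_segment S P a b \<gamma>" and "a \<le> a'" "a' < b'" "b' \<le> b"
  shows "curve_segment S P a' b' \<gamma>"
proof -
  have "vector_derivative (chart_map c \<circ> \<gamma>) (at s within {a'..b'})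
      = vector_derivative (chart_map c \<circ> \<gamma>) (at s within {a..b})"
    if "s \<in> {a'..b'}" "c \<in> charts S" "\<gamma> s \<in> chart_dom c" for c s
  proof -
    have "(chart_map c \<circ> \<gamma> has_vector_derivative vector_derivative (chart_map c \<circ> \<gamma>) (at s within {a..b}))
        (at s within {a..b})"
      using that assms by (intro smooth_curve_has_vector_derivative) (auto simp: curve_segment_def)
    then have "(chart_map c \<circ> \<gamma> has_vector_derivative vector_derivative (chart_map c \<circ> \<gamma>) (at s within {a..b}))
        (at s within {a'..b'})"
      by (rule has_vector_derivative_within_subset) (use assms in auto)
    then show ?thesis
      using that assms by (intro vector_derivative_within_closed_interval) auto
  qed
  then show ?thesis
    using assms smooth_curve_mono unfolding curve_segment_def by auto
qed

text \<open>The cut lies inside the first piece, at its end, or in the remaining chain, where the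
  induction hypothesis applies.\<close>

lemma curve_chain_split:
  assumes "curve_chain S P \<gamma> a b" "a < s" "s < b"
  shows "curve_chain S P \<gamma> a s \<and> curve_chain S P \<gamma> s b"
  using assms
proof (induction rule: curve_chain.induct)
  case (single a b)
  then show ?case
    by (auto intro!: curve_chain.single intro: curve_segment_mono)
next
  case (step a b c)
  then have "a < b" "b < c"
    using curve_chain_less by (auto simp: curve_segment_def)
  consider "s < b" | "s = b" | "s > b"
    by linarith
  then show ?case
  proof cases
    case 1
    then show ?thesis
      using step curve_segment_mono[of P a b \<gamma> a s] curve_segment_mono[of P a b \<gamma> s b]
      by (auto intro: curve_chain.intros)
  next
    case 2
    then show ?thesis
      using step by (auto intro: curve_chain.intros)
  next
    case 3
    then show ?thesis
      using step by (auto intro: curve_chain.intros)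
  qed
qed

end

section \<open>The metric in a chart\<close>

text \<open>Written through the inverse of \<open>L\<close>, the form is an explicit expression in
  inner products, whose bilinearity can be computed.\<close>

lemma bilinear_lorentzian_form:
  assumes "lorentzian_form B"
  shows "bilinear B"
  using assms unfolding lorentzian_form_def
proof (elim exE conjE)
  fix L :: "'a \<Rightarrow> 'a" and t
  assume L: "linear L" "bij L" and B: "\<forall>u v. B (L u) (L v) = u \<bullet> v - 2 * (u \<bullet> t) * (v \<bullet> t)"
  have K: "linear (inv L)"
    using L by (simp add: bij_is_inj inj_linear_imp_inv_linear)
  have B_inv: "B u v = inv L u \<bullet> inv L v - 2 * (inv L u \<bullet> t) * (inv L v \<bullet> t)" for u v
    using B[rule_format, of "inv L u" "inv L v"] L(2) by (simp add: bij_is_surj surj_f_inv_f)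
  show ?thesis
    unfolding bilinear_def linear_iff B_inv linear_add[OF K] linear_cmul[OF K] inner_simps
    by (simp add: algebra_simps)
qed

lemma commute_lorentzian_form:
  assumes "lorentzian_form B"
  shows "B u v = B v u"
  using assms unfolding lorentzian_form_def
proof (elim exE conjE)
  fix L :: "'a \<Rightarrow> 'a" and t
  assume "bij L" and B: "\<forall>u v. B (L u) (L v) = u \<bullet> v - 2 * (u \<bullet> t) * (v \<bullet> t)"
  then show ?thesis
    using B[rule_format, of "inv L u" "inv L v"] B[rule_format, of "inv L v" "inv L u"]
    by (simp add: bij_is_surj surj_f_inv_f inner_commute)
qed

section \<open>Coordinate expressions of the metric and of the time orientation\<close>

context spacetime_manifold
begin

definition coord_metric :: "('a, 'b) chart \<Rightarrow> 'b \<Rightarrow> 'b \<Rightarrow> 'b \<Rightarrow> real" where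
  "coord_metric c x = metric_tensor S c (chart_inv c x)"

definition coord_time_dir :: "('a, 'b) chart \<Rightarrow> 'b \<Rightarrow> 'b" where
  "coord_time_dir c x = time_dir S c (chart_inv c x)"

lemma lorentzian_coord_metric:
  "c \<in> charts S \<Longrightarrow> x \<in> chart_range c \<Longrightarrow> lorentzian_form (coord_metric c x)"
  using S by (auto simp: smooth_spacetime_def lorentzian_metric_def coord_metric_def)

lemmas bilinear_coord_metric = bilinear_lorentzian_form[OF lorentzian_coord_metric]
lemmas commute_coord_metric = commute_lorentzian_form[OF lorentzian_coord_metric]

text \<open>The smoothness of the metric is given for fixed vectors only. The expansion into
  finitely many components turns it into continuity and Lipschitz estimates that hold jointly in
  point and vectors.\<close>

lemma coord_metric_expand:
  assumes "c \<in> charts S" "x \<in> chart_range c"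
  shows "coord_metric c x u v = (\<Sum>i\<in>Basis. \<Sum>j\<in>Basis. (u \<bullet> i) * (v \<bullet> j) * coord_metric c x i j)"
proof -
  note bil = bilinear_coord_metric[OF assms]
  have "coord_metric c x u v
      = coord_metric c x (\<Sum>i\<in>Basis. (u \<bullet> i) *\<^sub>R i) (\<Sum>j\<in>Basis. (v \<bullet> j) *\<^sub>R j)"
    by (simp add: euclidean_representation)
  also have "\<dots> = (\<Sum>i\<in>Basis. \<Sum>j\<in>Basis. coord_metric c x ((u \<bullet> i) *\<^sub>R i) ((v \<bullet> j) *\<^sub>R j))"
    by (simp add: bilinear_sum[OF bil] sum.cartesian_product)
  finally show ?thesis
    by (simp add: bilinear_lmul[OF bil] bilinear_rmul[OF bil] ac_simps)
qed

lemma smooth_coord_metric: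
  "c \<in> charts S \<Longrightarrow> smooth_on (chart_range c) (\<lambda>x. coord_metric c x u v)"
  using S by (simp add: smooth_spacetime_def lorentzian_metric_def coord_metric_def)

lemma continuous_coord_metric:
  assumes c: "c \<in> charts S"
    and f: "continuous_on D f" "f ` D \<subseteq> chart_range c" and g: "continuous_on D g" and h: "continuous_on D h"
  shows "continuous_on D (\<lambda>z. coord_metric c (f z) (g z) (h z))"
proof -
  have "continuous_on D (\<lambda>z. coord_metric c (f z) u v)" for u v
    by (rule continuous_on_compose2[OF smooth_on_continuous[OF smooth_coord_metric[OF c]] f(1)])
       (rule f(2))
  then have "continuous_on D (\<lambda>z. \<Sum>i\<in>Basis. \<Sum>j\<in>Basis. (g z \<bullet> i) * (h z \<bullet> j) * coord_metric c (f z) i j)"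
    by (intro continuous_on_sum continuous_on_mult continuous_on_inner continuous_on_const g h)
  then show ?thesis
    by (rule continuous_on_eq) (use f(2) c in \<open>auto simp: coord_metric_expand[symmetric] subset_iff\<close>)
qed

lemma continuous_coord_time_dir:
  assumes c: "c \<in> charts S"
  shows "continuous_on (chart_range c) (coord_time_dir c)"
proof -
  have "continuous_on (chart_dom c) (time_dir S c)"
    using S c by (simp add: smooth_spacetime_def time_orientation_def)
  then show ?thesis
    unfolding coord_time_dir_def
    by (rule continuous_on_compose2[OF _ continuous_chart_inv[OF c]]) (use c in auto)
qed

lemma coord_time_dir_timelike:
  assumes "c \<in> charts S" "x \<in> chart_range c"
  shows "coord_metric c x (coord_time_dir c x) (coord_time_dir c x) < 0"
  using S assms by (auto simp: smooth_spacetime_def time_orientation_def coord_metric_def coord_time_dir_def)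

text \<open>The bundle of future cones is taken as a subset of the product of coordinates and
  vectors, so that its openness controls a point and a velocity that vary together.\<close>

definition timelike_cone :: "('a, 'b) chart \<Rightarrow> ('b \<times> 'b) set" where
  "timelike_cone c = {(x, v). x \<in> chart_range c \<and> coord_metric c x v v < 0 \<and>
     coord_metric c x (coord_time_dir c x) v < 0}"

lemma open_timelike_cone:
  assumes c: "c \<in> charts S"
  shows "open (timelike_cone c)"
proof -
  let ?D = "chart_range c \<times> (UNIV :: 'b set)"
  have D: "open ?D"
    using open_range[OF c] by (simp add: open_Times)
  have "continuous_on ?D (\<lambda>z. coord_time_dir c (fst z))"
    by (rule continuous_on_compose2[OF continuous_coord_time_dir[OF c]]) (auto intro: continuous_intros)
  then have cont: "continuous_on ?D (\<lambda>z. coord_metric c (fst z) (snd z) (snd z))"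
    "continuous_on ?D (\<lambda>z. coord_metric c (fst z) (coord_time_dir c (fst z)) (snd z))"
    by (auto intro!: continuous_coord_metric[OF c] continuous_intros)
  have "timelike_cone c = (?D \<inter> (\<lambda>z. coord_metric c (fst z) (snd z) (snd z)) -` {..<0}) \<inter>
      (?D \<inter> (\<lambda>z. coord_metric c (fst z) (coord_time_dir c (fst z)) (snd z)) -` {..<0})"
    by (auto simp: timelike_cone_def)
  then show ?thesis
    using continuous_open_preimage[OF cont(1) D open_lessThan] continuous_open_preimage[OF cont(2) D open_lessThan]
    by (simp add: open_Int)
qed

lemma future_timelike_iff_cone:
  assumes "c \<in> charts S" "p \<in> chart_dom c"
  shows "future_timelike S c p v \<longleftrightarrow> (chart_map c p, v) \<in> timelike_cone c"
  using assms by (auto simp: timelike_cone_def future_timelike_def coord_metric_def coord_time_dir_def)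

text \<open>Metric and time orientation both transform by \<open>tangent_change\<close>, so the
  condition may be checked in a single chart although curves require it in all of them.\<close>

lemma future_timelike_change:
  assumes "c \<in> charts S" "d \<in> charts S" "p \<in> chart_dom c" "p \<in> chart_dom d" "future_timelike S c p v"
  shows "future_timelike S d p (tangent_change c d p v)"
proof -
  have g: "metric_tensor S d p (tangent_change c d p u) (tangent_change c d p w) = metric_tensor S c p u w" for u w
    using S assms(1-4) by (simp add: smooth_spacetime_def lorentzian_metric_def)
  have "tangent_change c d p (time_dir S c p) = time_dir S d p"
    using S assms(1-4) by (simp add: smooth_spacetime_def time_orientation_def)
  with g[of v v] g[of "time_dir S c p" v] assms(5) show ?thesis
    by (simp add: future_timelike_def)
qed

text \<open>The curve \<open>chart_inv c (f s)\<close> has velocity \<open>f'\<close> in the chart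
  \<open>c\<close>, and its velocity in any other chart is the image under the tangent change, hence
  again future timelike. All timelike curves built below from coordinate formulas arise in this
  way.\<close>

lemma chronology_in_chart:
  assumes c: "c \<in> charts S" and ab: "a < b" and X: "open X" "{a..b} \<subseteq> X"
    and f: "smooth_on X f" and cone: "\<And>s. s \<in> {a..b} \<Longrightarrow> (f s, vector_derivative f (at s)) \<in> timelike_cone c"
  shows "chronology S (chart_inv c (f a)) (chart_inv c (f b))"
proof -
  define \<gamma> where "\<gamma> s = chart_inv c (f s)" for s
  have range: "f s \<in> chart_range c" if "s \<in> {a..b}" for s
    using cone[OF that] by (simp add: timelike_cone_def)
  have dom: "\<gamma> s \<in> chart_dom c" and f_eq: "chart_map c (\<gamma> s) = f s" if "s \<in> {a..b}" for s
    using range[OF that] c by (auto simp: \<gamma>_def)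
  have "smooth_curve S a b \<gamma>"
    unfolding smooth_curve_def
  proof
    fix s assume "s \<in> {a..b}"
    then obtain e where "e > 0" "ball s e \<subseteq> X"
      using X open_contains_ball by blast
    then show "\<exists>c\<in>charts S. \<exists>\<epsilon>>0. \<exists>f. smooth_on (ball s \<epsilon>) f \<and>
        (\<forall>r\<in>{a..b} \<inter> ball s \<epsilon>. \<gamma> r \<in> chart_dom c \<and> chart_map c (\<gamma> r) = f r)"
      using dom f_eq smooth_on_subset[OF f] c by (intro bexI[of _ c] exI[of _ e] conjI exI[of _ f]) auto
  qed
  moreover have "future_timelike S d (\<gamma> s) (vector_derivative (chart_map d \<circ> \<gamma>) (at s within {a..b}))"
    if s: "s \<in> {a..b}" and d: "d \<in> charts S" "\<gamma> s \<in> chart_dom d" for s d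
  proof -
    let ?v = "vector_derivative f (at s)"
    have "(f has_vector_derivative ?v) (at s within {a..b})"
      by (rule has_vector_derivative_at_within[OF smooth_on_has_vector_derivative[OF f]])
        (use s X(2) in blast)
    then have "(chart_map c \<circ> \<gamma> has_vector_derivative ?v) (at s within {a..b})"
      by (rule has_vector_derivative_transform_within[OF _ zero_less_one s]) (simp add: f_eq)
    then have "(chart_map d \<circ> \<gamma> has_vector_derivative tangent_change c d (\<gamma> s) ?v) (at s within {a..b})"
      \<comment> \<open>Any radius serves here, since the whole curve lies in the domain of
        \<open>c\<close>.\<close>
      using dom by (intro chart_change_has_vector_derivative[where e = 1] c d s) auto
    then have "vector_derivative (chart_map d \<circ> \<gamma>) (at s within {a..b}) = tangent_change c d (\<gamma> s) ?v"
      by (rule vector_derivative_within_closed_interval[OF ab s])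
    moreover have "future_timelike S c (\<gamma> s) ?v"
      using cone[OF s] dom[OF s] f_eq[OF s] by (simp add: future_timelike_iff_cone c)
    ultimately show ?thesis
      using future_timelike_change[OF c d(1) dom[OF s] d(2)] by simp
  qed
  ultimately have "curve_segment S (future_timelike S) a b \<gamma>"
    using ab by (simp add: curve_segment_def)
  then show ?thesis
    unfolding chronology_iff_chain using curve_chain.single by (metis \<gamma>_def)
qed

text \<open>The open cone contains a product of balls around \<open>(x0, v0)\<close>. The straight
  line from \<open>x\<close> to \<open>y\<close> run over \<open>{0..h}\<close> has the constant
  velocity \<open>(y - x) /\<^sub>R h\<close> and stays in the convex ball, so it is timelike.
  Leaving \<open>h\<close> free allows difference quotients to be compared with
  \<open>v0\<close>.\<close>

lemma chronology_line:
  assumes c: "c \<in> charts S" and cone: "(x0, v0) \<in> timelike_cone c"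
  shows "\<exists>r>0. \<forall>x\<in>ball x0 r. \<forall>y\<in>ball x0 r. \<forall>h>0. norm ((y - x) /\<^sub>R h - v0) < r \<longrightarrow>
    chronology S (chart_inv c x) (chart_inv c y)"
proof -
  obtain A B where AB: "open A" "open B" "(x0, v0) \<in> A \<times> B" "A \<times> B \<subseteq> timelike_cone c"
    using open_timelike_cone[OF c] cone by (rule open_prod_elim)
  then obtain r1 r2 where r: "r1 > 0" "ball x0 r1 \<subseteq> A" "r2 > 0" "ball v0 r2 \<subseteq> B"
    by (metis mem_Times_iff fst_conv snd_conv open_contains_ball)
  show ?thesis
  proof (intro exI[of _ "min r1 r2"] conjI ballI allI impI)
    fix x y and h :: real
    assume xy: "x \<in> ball x0 (min r1 r2)" "y \<in> ball x0 (min r1 r2)" and h: "h > 0"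
      "norm ((y - x) /\<^sub>R h - v0) < min r1 r2"
    let ?v = "(y - x) /\<^sub>R h"
    let ?f = "\<lambda>s::real. x + s *\<^sub>R ?v"
    have deriv: "vector_derivative ?f (at s) = ?v" for s
      by (intro vector_derivative_at) (auto intro!: derivative_eq_intros)
    have "?f s \<in> ball x0 r1" if "s \<in> {0..h}" for s
    proof -
      have "?f s = (1 - s / h) *\<^sub>R x + (s / h) *\<^sub>R y"
        using h(1) by (simp add: algebra_simps divide_inverse)
      also have "\<dots> \<in> ball x0 r1"
        using xy that h(1) by (intro convexD) auto
      finally show ?thesis .
    qed
    moreover have "?v \<in> ball v0 r2"
      using h(2) by (simp add: dist_norm norm_minus_commute)
    ultimately have "(?f s, ?v) \<in> timelike_cone c" if "s \<in> {0..h}" for s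
      using AB(4) r that by blast
    then have "(?f s, vector_derivative ?f (at s)) \<in> timelike_cone c" if "s \<in> {0..h}" for s
      using that unfolding deriv .
    from chronology_in_chart[OF c h(1) open_UNIV subset_UNIV smooth_on_affine this]
    show "chronology S (chart_inv c x) (chart_inv c y)"
      using h(1) by simp
  qed (use r in auto)
qed

end

section \<open>Openness of chronological pasts and futures\<close>

lemma in_closure_Collect_iff:
  "x \<in> closure {z. Q z} \<longleftrightarrow> (\<forall>V. open V \<longrightarrow> x \<in> V \<longrightarrow> (\<exists>z\<in>V. Q z))"
  unfolding closure_iff_nhds_not_empty by blast

lemma curve_chain_first:
  "curve_chain S P \<gamma> a b \<Longrightarrow> \<exists>c. curve_segment S P a c \<gamma> \<and> c \<le> b"
  by (cases rule: curve_chain.cases) (auto dest: curve_chain_less intro: less_imp_le)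

lemma curve_chain_last:
  "curve_chain S P \<gamma> a b \<Longrightarrow> \<exists>c. curve_segment S P c b \<gamma> \<and> a \<le> c"
proof (induction rule: curve_chain.induct)
  case (single a b)
  then show ?case
    by blast
next
  case (step a b c)
  then have "a \<le> b"
    by (simp add: curve_segment_def)
  with step.IH show ?case
    by (meson order_trans)
qed

lemma norm_divideR_le:
  fixes w :: "'a::real_normed_vector"
  shows "h > 0 \<Longrightarrow> norm w \<le> k * h \<Longrightarrow> norm (w /\<^sub>R h) \<le> k"
  by (simp add: field_simps)

lemma norm_divideR_less:
  fixes w :: "'a::real_normed_vector"
  shows "h > 0 \<Longrightarrow> norm w < k * h \<Longrightarrow> norm (w /\<^sub>R h) < k"
  by (simp add: field_simps)

context spacetime_manifold
begin

text \<open>Near one parameter the curve extends in coordinates to a smooth map on a full ball. Its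
  two-sided derivative agrees with the velocity within the interval, also at the ends, and therefore
  satisfies \<open>P\<close>.\<close>

lemma curve_segment_coordinates:
  assumes seg: "curve_segment S P a b \<gamma>" and s: "s \<in> {a..b}"
  obtains c \<epsilon> f where "c \<in> charts S" "\<epsilon> > 0" "smooth_on (ball s \<epsilon>) f"
    "\<And>r. r \<in> {a..b} \<Longrightarrow> dist r s < \<epsilon> \<Longrightarrow> \<gamma> r \<in> chart_dom c"
    "\<And>r. r \<in> {a..b} \<Longrightarrow> dist r s < \<epsilon> \<Longrightarrow> chart_map c (\<gamma> r) = f r"
    "\<And>r. r \<in> {a..b} \<Longrightarrow> dist r s < \<epsilon> \<Longrightarrow> P c (\<gamma> r) (vector_derivative f (at r))"
proof -
  have \<gamma>: "smooth_curve S a b \<gamma>" and "a < b"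
    using seg by (auto simp: curve_segment_def)
  obtain c \<epsilon> f where c: "c \<in> charts S" "\<epsilon> > 0" "smooth_on (ball s \<epsilon>) f"
    and f: "\<And>r. r \<in> {a..b} \<Longrightarrow> dist r s < \<epsilon> \<Longrightarrow> \<gamma> r \<in> chart_dom c"
      "\<And>r. r \<in> {a..b} \<Longrightarrow> dist r s < \<epsilon> \<Longrightarrow> chart_map c (\<gamma> r) = f r"
    using smooth_curveE[OF \<gamma> s] by metis
  have "P c (\<gamma> r) (vector_derivative f (at r))" if r: "r \<in> {a..b}" "dist r s < \<epsilon>" for r
  proof -
    have "(f has_vector_derivative vector_derivative f (at r)) (at r within {a..b})"
      by (rule has_vector_derivative_at_within[OF smooth_on_has_vector_derivative[OF c(3)]])
        (use r in \<open>simp add: dist_commute\<close>)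
    then have "(chart_map c \<circ> \<gamma> has_vector_derivative vector_derivative f (at r)) (at r within {a..b})"
    proof (rule has_vector_derivative_transform_within[OF _ _ r(1)])
      show "0 < \<epsilon> - dist r s"
        using r(2) by simp
      fix t assume t: "t \<in> {a..b}" "dist t r < \<epsilon> - dist r s"
      have "dist t s < \<epsilon>"
        using t(2) dist_triangle[of t s r] by linarith
      then show "f t = (chart_map c \<circ> \<gamma>) t"
        using f(2)[OF t(1)] by simp
    qed
    then have "vector_derivative (chart_map c \<circ> \<gamma>) (at r within {a..b}) = vector_derivative f (at r)"
      by (rule vector_derivative_within_closed_interval[OF \<open>a < b\<close> r(1)])
    then show ?thesis
      using seg r(1) c(1) f(1)[OF r] unfolding curve_segment_def by metis
  qed
  with c f show thesis
    using that by blast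
qed

text \<open>The difference quotient of the curve between \<open>s\<close> and a nearby
  \<open>r\<close> is close to the velocity at \<open>s\<close>. If the point at \<open>s\<close> is
  displaced by little compared with the distance of \<open>s\<close> and \<open>r\<close>, the
  quotient stays close, so the straight line to or from the other point is still timelike.\<close>

lemma timelike_segment_neighbourhood:
  assumes seg: "curve_segment S (future_timelike S) a b \<gamma>" and s: "s \<in> {a..b}"
  shows "\<exists>d>0. \<forall>r\<in>{a..b}. dist r s < d \<longrightarrow>
    (s < r \<longrightarrow> (\<exists>T. open T \<and> \<gamma> s \<in> T \<and> (\<forall>x\<in>T. chronology S x (\<gamma> r)))) \<and>
    (r < s \<longrightarrow> (\<exists>T. open T \<and> \<gamma> s \<in> T \<and> (\<forall>x\<in>T. chronology S (\<gamma> r) x)))"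
proof -
  obtain c \<epsilon> f where c: "c \<in> charts S" and \<epsilon>: "\<epsilon> > 0" and smooth: "smooth_on (ball s \<epsilon>) f"
    and dom: "\<And>r. r \<in> {a..b} \<Longrightarrow> dist r s < \<epsilon> \<Longrightarrow> \<gamma> r \<in> chart_dom c"
    and map: "\<And>r. r \<in> {a..b} \<Longrightarrow> dist r s < \<epsilon> \<Longrightarrow> chart_map c (\<gamma> r) = f r"
    and timelike: "\<And>r. r \<in> {a..b} \<Longrightarrow> dist r s < \<epsilon> \<Longrightarrow> future_timelike S c (\<gamma> r) (vector_derivative f (at r))"
    using curve_segment_coordinates[OF seg s] by metis
  define v where "v = vector_derivative f (at s)"
  have dom_s: "\<gamma> s \<in> chart_dom c" and map_s: "chart_map c (\<gamma> s) = f s"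
    using dom[OF s] map[OF s] \<epsilon> by auto
  have "(f s, v) \<in> timelike_cone c"
    using timelike[OF s] \<epsilon> dom_s map_s future_timelike_iff_cone[OF c dom_s] by (simp add: v_def)
  then obtain \<rho> where \<rho>: "\<rho> > 0" and line: "\<And>x y h. \<lbrakk>x \<in> ball (f s) \<rho>; y \<in> ball (f s) \<rho>; h > 0;
      norm ((y - x) /\<^sub>R h - v) < \<rho>\<rbrakk> \<Longrightarrow> chronology S (chart_inv c x) (chart_inv c y)"
    using chronology_line[OF c] by metis
  have deriv: "(f has_vector_derivative v) (at s)"
    unfolding v_def using \<epsilon> by (intro smooth_on_has_vector_derivative[OF smooth]) simp
  \<comment> \<open>Half of the tolerance \<open>\<rho>\<close> is spent on the difference quotient,
    the other half on the displacement of the point.\<close>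
  then obtain d1 where d1: "d1 > 0"
    "\<And>r. norm (r - s) < d1 \<Longrightarrow> norm (f r - f s - (r - s) *\<^sub>R v) \<le> \<rho> / 2 * norm (r - s)"
    using \<rho> unfolding has_vector_derivative_def has_derivative_at_alt by (metis half_gt_zero)
  have "isCont f s"
    using deriv by (rule has_vector_derivative_continuous)
  then obtain d2 where d2: "d2 > 0" "\<And>r. dist r s < d2 \<Longrightarrow> dist (f r) (f s) < \<rho>"
    using \<rho> unfolding continuous_at_eps_delta by metis
  have nbhd: "open (chart_dom c \<inter> chart_map c -` ball (f s) \<sigma>)" for \<sigma>
    using continuous_open_preimage[OF continuous_chart_map[OF c] open_dom[OF c] open_ball] .
  show ?thesis
  proof (intro exI[of _ "min \<epsilon> (min d1 d2)"] conjI ballI impI)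
    fix r assume r: "r \<in> {a..b}" "dist r s < min \<epsilon> (min d1 d2)" "s < r"
    \<comment> \<open>The radius is proportional to \<open>r - s\<close>, so that the displacement,
      divided by \<open>r - s\<close>, stays below \<open>\<rho> / 2\<close>.\<close>
    let ?T = "chart_dom c \<inter> chart_map c -` ball (f s) (min \<rho> ((r - s) * (\<rho> / 2)))"
    have "chronology S x (\<gamma> r)" if x: "x \<in> ?T" for x
    proof -
      let ?x = "chart_map c x"
      have "norm ((f r - f s - (r - s) *\<^sub>R v) /\<^sub>R (r - s)) \<le> \<rho> / 2"
        using d1(2)[of r] r by (intro norm_divideR_le) (simp_all add: dist_real_def)
      moreover have "norm ((f s - ?x) /\<^sub>R (r - s)) < \<rho> / 2"
        using x r(3) by (intro norm_divideR_less) (simp_all add: dist_norm mult.commute)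
      moreover have "inverse (r - s) * (r - s) = 1"
        using r(3) by simp
      then have "(f r - ?x) /\<^sub>R (r - s) - v
          = (f r - f s - (r - s) *\<^sub>R v) /\<^sub>R (r - s) + (f s - ?x) /\<^sub>R (r - s)"
        unfolding scaleR_right_diff_distrib scaleR_scaleR by simp
      ultimately have "norm ((f r - ?x) /\<^sub>R (r - s) - v) < \<rho>"
        using norm_triangle_ineq[of "(f r - f s - (r - s) *\<^sub>R v) /\<^sub>R (r - s)" "(f s - ?x) /\<^sub>R (r - s)"]
        by simp
      then have "chronology S (chart_inv c ?x) (chart_inv c (f r))"
        using x r d2(2)[of r] by (intro line[of _ _ "r - s"]) (auto simp: dist_commute)
      then show ?thesis
        using x c dom[of r] map[of r] r by (metis IntE chart_inv_map min_less_iff_conj)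
    qed
    moreover have "\<gamma> s \<in> ?T"
      using dom_s map_s \<rho> r(3) by simp
    ultimately show "\<exists>T. open T \<and> \<gamma> s \<in> T \<and> (\<forall>x\<in>T. chronology S x (\<gamma> r))"
      using nbhd by blast
  next
    fix r assume r: "r \<in> {a..b}" "dist r s < min \<epsilon> (min d1 d2)" "r < s"
    let ?T = "chart_dom c \<inter> chart_map c -` ball (f s) (min \<rho> ((s - r) * (\<rho> / 2)))"
    have "chronology S (\<gamma> r) x" if x: "x \<in> ?T" for x
    proof -
      let ?x = "chart_map c x"
      have "norm ((f r - f s - (r - s) *\<^sub>R v) /\<^sub>R (s - r)) \<le> \<rho> / 2"
        using d1(2)[of r] r by (intro norm_divideR_le) (simp_all add: dist_real_def)
      moreover have "norm ((f s - ?x) /\<^sub>R (s - r)) < \<rho> / 2"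
        using x r(3) by (intro norm_divideR_less) (simp_all add: dist_norm mult.commute)
      \<comment> \<open>The line now runs from \<open>r\<close> to \<open>s\<close>, and dividing by
        the positive length \<open>s - r\<close> reverses the sign of the first-order term.\<close>
      moreover have "inverse (s - r) * (r - s) = - 1"
        using r(3) by (simp add: field_simps)
      then have "(?x - f r) /\<^sub>R (s - r) - v
          = - ((f r - f s - (r - s) *\<^sub>R v) /\<^sub>R (s - r) + (f s - ?x) /\<^sub>R (s - r))"
        unfolding scaleR_right_diff_distrib scaleR_scaleR by simp
      ultimately have "norm ((?x - f r) /\<^sub>R (s - r) - v) < \<rho>"
        using norm_triangle_ineq[of "(f r - f s - (r - s) *\<^sub>R v) /\<^sub>R (s - r)" "(f s - ?x) /\<^sub>R (s - r)"]
        by (simp only: norm_minus_cancel)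
      then have "chronology S (chart_inv c (f r)) (chart_inv c ?x)"
        using x r d2(2)[of r] by (intro line[of _ _ "s - r"]) (auto simp: dist_commute)
      then show ?thesis
        using x c dom[of r] map[of r] r by (metis IntE chart_inv_map min_less_iff_conj)
    qed
    moreover have "\<gamma> s \<in> ?T"
      using dom_s map_s \<rho> r(3) by simp
    ultimately show "\<exists>T. open T \<and> \<gamma> s \<in> T \<and> (\<forall>x\<in>T. chronology S (\<gamma> r) x)"
      using nbhd by blast
  qed (use \<epsilon> d1 d2 in auto)
qed

text \<open>Only the beginning of the curve has to be changed: a neighbourhood of \<open>x\<close>
  precedes some point on the first piece, and the rest of the curve leads from that point to
  \<open>y\<close>.\<close>

lemma open_chronological_past: "open {x. chronology S x y}"
proof (subst open_subopen, intro ballI)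
  fix x assume "x \<in> {x. chronology S x y}"
  then obtain a b \<gamma> where \<gamma>: "curve_chain S (future_timelike S) \<gamma> a b" "\<gamma> a = x" "\<gamma> b = y"
    unfolding chronology_iff_chain by blast
  obtain c where c: "curve_segment S (future_timelike S) a c \<gamma>" "c \<le> b"
    using curve_chain_first[OF \<gamma>(1)] by blast
  then have "a < c"
    by (simp add: curve_segment_def)
  then obtain d where d: "d > 0"
    "\<And>r. r \<in> {a..c} \<Longrightarrow> dist r a < d \<Longrightarrow> a < r \<Longrightarrow> \<exists>T. open T \<and> x \<in> T \<and> (\<forall>z\<in>T. chronology S z (\<gamma> r))"
    using timelike_segment_neighbourhood[OF c(1), of a] \<gamma>(2) by auto
  \<comment> \<open>The halved minimum keeps the parameter strictly inside the first piece and
    within distance \<open>d\<close> of its start.\<close>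
  define r where "r = a + min d (c - a) / 2"
  have r: "a < r" "r < c" "r < a + d"
    using d(1) \<open>a < c\<close> by (auto simp: r_def min_def field_simps)
  then obtain T where T: "open T" "x \<in> T" "\<And>z. z \<in> T \<Longrightarrow> chronology S z (\<gamma> r)"
    using d(2)[of r] by (auto simp: dist_real_def)
  have "curve_chain S (future_timelike S) \<gamma> r b"
    using curve_chain_split[OF \<gamma>(1)] r c(2) by auto
  then have "chronology S (\<gamma> r) y"
    unfolding chronology_iff_chain using \<gamma>(3) by blast
  then have "T \<subseteq> {x. chronology S x y}"
    using T(3) by (auto intro: chronology_trans)
  with T(1,2) show "\<exists>T. open T \<and> x \<in> T \<and> T \<subseteq> {x. chronology S x y}"
    by (intro exI[of _ T] conjI)
qed

text \<open>The dual argument changes the curve on its last piece.\<close>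

lemma open_chronological_future: "open {y. chronology S x y}"
proof (subst open_subopen, intro ballI)
  fix y assume "y \<in> {y. chronology S x y}"
  then obtain a b \<gamma> where \<gamma>: "curve_chain S (future_timelike S) \<gamma> a b" "\<gamma> a = x" "\<gamma> b = y"
    unfolding chronology_iff_chain by blast
  obtain c where c: "curve_segment S (future_timelike S) c b \<gamma>" "a \<le> c"
    using curve_chain_last[OF \<gamma>(1)] by blast
  then have "c < b"
    by (simp add: curve_segment_def)
  then obtain d where d: "d > 0"
    "\<And>r. r \<in> {c..b} \<Longrightarrow> dist r b < d \<Longrightarrow> r < b \<Longrightarrow> \<exists>T. open T \<and> y \<in> T \<and> (\<forall>z\<in>T. chronology S (\<gamma> r) z)"
    using timelike_segment_neighbourhood[OF c(1), of b] \<gamma>(3) by auto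
  define r where "r = b - min d (b - c) / 2"
  have r: "r < b" "c < r" "b < r + d"
    using d(1) \<open>c < b\<close> by (auto simp: r_def min_def field_simps)
  then obtain T where T: "open T" "y \<in> T" "\<And>z. z \<in> T \<Longrightarrow> chronology S (\<gamma> r) z"
    using d(2)[of r] by (auto simp: dist_real_def)
  have "curve_chain S (future_timelike S) \<gamma> a r"
    using curve_chain_split[OF \<gamma>(1)] r c(2) by auto
  then have "chronology S x (\<gamma> r)"
    unfolding chronology_iff_chain using \<gamma>(2) by blast
  then have "T \<subseteq> {y. chronology S x y}"
    using T(3) by (auto intro: chronology_trans)
  with T(1,2) show "\<exists>T. open T \<and> y \<in> T \<and> T \<subseteq> {y. chronology S x y}"
    by (intro exI[of _ T] conjI)
qed

section \<open>Approximation of causal precedence by chronological precedence\<close>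

lemma chart_inv_neighbourhood:
  assumes c: "c \<in> charts S" and x: "x \<in> chart_range c" and V: "open V" "chart_inv c x \<in> V"
  shows "\<exists>\<rho>>0. ball x \<rho> \<subseteq> chart_range c \<and> (\<forall>y\<in>ball x \<rho>. chart_inv c y \<in> V)"
proof -
  have "open (chart_range c \<inter> chart_inv c -` V)"
    using continuous_open_preimage[OF continuous_chart_inv[OF c] open_range[OF c] V(1)] .
  then show ?thesis
    using x V(2) unfolding open_contains_ball by blast
qed

text \<open>A short straight step against the time direction reaches chronological predecessors in
  every neighbourhood; divided by its parameter length it is exactly the timelike vector
  \<open>?T\<close>.\<close>

lemma in_closure_chronological_past: "x \<in> closure {z. chronology S z x}"
proof -
  obtain c where c: "c \<in> charts S" "x \<in> chart_dom c"
    using chart_exists by blast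
  define x0 where "x0 = chart_map c x"
  have x0: "x0 \<in> chart_range c" "chart_inv c x0 = x"
    using c by (auto simp: x0_def)
  let ?T = "coord_time_dir c x0"
  have "(x0, ?T) \<in> timelike_cone c"
    using coord_time_dir_timelike[OF c(1) x0(1)] x0(1) by (simp add: timelike_cone_def)
  then obtain r where r: "r > 0" and line: "\<And>x y h. \<lbrakk>x \<in> ball x0 r; y \<in> ball x0 r; h > 0;
      norm ((y - x) /\<^sub>R h - ?T) < r\<rbrakk> \<Longrightarrow> chronology S (chart_inv c x) (chart_inv c y)"
    using chronology_line[OF c(1)] by metis
  have "\<exists>z\<in>V. chronology S z x" if V: "open V" "x \<in> V" for V
  proof -
    obtain \<rho> where \<rho>: "\<rho> > 0" "\<And>y. y \<in> ball x0 \<rho> \<Longrightarrow> chart_inv c y \<in> V"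
      using chart_inv_neighbourhood[OF c(1) x0(1) V(1)] V(2) x0(2) by auto
    \<comment> \<open>The summand one keeps the denominator positive and makes the step strictly
      shorter than both radii.\<close>
    define h where "h = min r \<rho> / (norm ?T + 1)"
    have T: "norm ?T + 1 > 0"
      by (simp add: add_nonneg_pos)
    have h: "h > 0"
      using r \<rho> T by (simp add: h_def)
    have "h * norm ?T < h * (norm ?T + 1)"
      using h by simp
    also have "\<dots> = min r \<rho>"
      using T by (simp add: h_def)
    finally have small: "h * norm ?T < min r \<rho>" .
    have "chronology S (chart_inv c (x0 - h *\<^sub>R ?T)) (chart_inv c x0)"
      using small r h by (intro line[of _ _ h]) (auto simp: dist_norm)
    moreover have "chart_inv c (x0 - h *\<^sub>R ?T) \<in> V"
      using small h by (intro \<rho>(2)) (auto simp: dist_norm)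
    ultimately show ?thesis
      using x0(2) by auto
  qed
  then show ?thesis
    by (simp add: in_closure_Collect_iff)
qed

text \<open>A point \<open>z\<close> near \<open>x\<close> has \<open>y\<close> in its open
  chronological future, so this future also contains a point that precedes \<open>w\<close>.\<close>

lemma closure_chronological_past_trans:
  assumes "x \<in> closure {z. chronology S z y}" "y \<in> closure {z. chronology S z w}"
  shows "x \<in> closure {z. chronology S z w}"
  unfolding in_closure_Collect_iff
proof (intro allI impI)
  fix V assume "open V" "x \<in> V"
  then obtain z where z: "z \<in> V" "chronology S z y"
    using assms(1) unfolding in_closure_Collect_iff by metis
  then obtain y' where "chronology S z y'" "chronology S y' w"
    using assms(2) open_chronological_future[of z] unfolding in_closure_Collect_iff by (metis mem_Collect_eq)
  then have "chronology S z w"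
    by (rule chronology_trans)
  with z(1) show "\<exists>z\<in>V. chronology S z w"
    by (rule bexI[rotated])
qed

text \<open>Each of the finitely many components is locally Lipschitz. The least radius serves for
  all of them, their constants add up, and the components of \<open>v\<close> are bounded by its
  norm.\<close>

lemma coord_metric_locally_Lipschitz:
  assumes c: "c \<in> charts S" and x0: "x0 \<in> chart_range c"
  shows "\<exists>r>0. \<exists>L\<ge>0. ball x0 r \<subseteq> chart_range c \<and>
    (\<forall>x\<in>ball x0 r. \<forall>y\<in>ball x0 r. \<forall>v.
      coord_metric c y v v \<le> coord_metric c x v v + L * norm (y - x) * (norm v)\<^sup>2)"
proof -
  let ?g = "\<lambda>i j x. coord_metric c x i j"
  have "\<exists>r L. r > 0 \<and> L \<ge> 0 \<and> ball x0 r \<subseteq> chart_range c \<and>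
      (\<forall>x\<in>ball x0 r. \<forall>y\<in>ball x0 r. \<bar>?g i j y - ?g i j x\<bar> \<le> L * norm (y - x))" for i j
    using smooth_on_locally_Lipschitz[OF open_range[OF c] smooth_coord_metric[OF c] x0, of i j] by blast
  then obtain r L where r: "\<And>i j. r i j > 0" "\<And>i j. ball x0 (r i j) \<subseteq> chart_range c"
    and L: "\<And>i j. L i j \<ge> 0"
      "\<And>i j x y. x \<in> ball x0 (r i j) \<Longrightarrow> y \<in> ball x0 (r i j) \<Longrightarrow> \<bar>?g i j y - ?g i j x\<bar> \<le> L i j * norm (y - x)"
    by metis
  define \<rho> where "\<rho> = Min ((\<lambda>(i, j). r i j) ` (Basis \<times> Basis))"
  define K where "K = (\<Sum>i\<in>Basis. \<Sum>j\<in>Basis. L i j)"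
  have \<rho>: "\<rho> > 0"
    using r(1) by (auto simp: \<rho>_def)
  have \<rho>_le: "\<rho> \<le> r i j" if "i \<in> Basis" "j \<in> Basis" for i j
    using that by (auto simp: \<rho>_def intro!: Min_le)
  obtain i0 :: 'b where "i0 \<in> Basis"
    using nonempty_Basis by blast
  then have range: "ball x0 \<rho> \<subseteq> chart_range c"
    using subset_ball[OF \<rho>_le[of i0 i0], of x0] r(2)[of i0 i0] by (metis order_trans)
  have "coord_metric c y v v \<le> coord_metric c x v v + K * norm (y - x) * (norm v)\<^sup>2"
    if xy: "x \<in> ball x0 \<rho>" "y \<in> ball x0 \<rho>" for x y v
  proof -
    have "coord_metric c y v v - coord_metric c x v v
        = (\<Sum>i\<in>Basis. \<Sum>j\<in>Basis. (v \<bullet> i) * (v \<bullet> j) * (?g i j y - ?g i j x))"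
      using coord_metric_expand[OF c, of y v v] coord_metric_expand[OF c, of x v v] xy range
      by (simp add: subset_iff sum_subtractf right_diff_distrib)
    also have "\<dots> \<le> (\<Sum>i\<in>Basis. \<Sum>j\<in>Basis. norm v * norm v * (L i j * norm (y - x)))"
    proof (intro sum_mono)
      fix i j :: 'b assume ij: "i \<in> Basis" "j \<in> Basis"
      have "(v \<bullet> i) * (v \<bullet> j) * (?g i j y - ?g i j x) \<le> \<bar>v \<bullet> i\<bar> * \<bar>v \<bullet> j\<bar> * \<bar>?g i j y - ?g i j x\<bar>"
        by (metis abs_ge_self abs_mult)
      also have "\<dots> \<le> norm v * norm v * (L i j * norm (y - x))"
        using Basis_le_norm[OF ij(1), of v] Basis_le_norm[OF ij(2), of v] L(2)[of x i j y] xy \<rho>_le[OF ij]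
        by (intro mult_mono) auto
      finally show "(v \<bullet> i) * (v \<bullet> j) * (?g i j y - ?g i j x) \<le> norm v * norm v * (L i j * norm (y - x))" .
    qed
    also have "\<dots> = K * norm (y - x) * (norm v)\<^sup>2"
      by (simp add: K_def power2_eq_square sum_distrib_left sum_distrib_right mult.assoc mult.commute mult.left_commute)
    finally show ?thesis
      by simp
  qed
  then show ?thesis
    using \<rho> range L(1) by (intro exI[of _ \<rho>] conjI exI[of _ K]) (auto simp: K_def sum_nonneg)
qed

text \<open>The bound \<open>d\<close> works for all short intervals around \<open>s0\<close>, as a
  bisection argument requires. Pushing the curve by a multiple \<open>e\<close> of a timelike vector
  gains at least \<open>2 * e * \<kappa>\<close> through the mixed term of the metric, while the
  change of the base point costs at most \<open>e * \<kappa>\<close>.\<close>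

lemma causal_segment_locally_in_closure:
  assumes seg: "curve_segment S (future_causal S) a b \<gamma>" and s0: "s0 \<in> {a..b}"
  shows "\<exists>d>0. \<forall>u v. a \<le> u \<and> u \<le> s0 \<and> s0 \<le> v \<and> v \<le> b \<and> v - u < d \<longrightarrow>
    \<gamma> u \<in> closure {z. chronology S z (\<gamma> v)}"
proof -
  obtain c \<epsilon> f where c: "c \<in> charts S" and \<epsilon>: "\<epsilon> > 0" and smooth: "smooth_on (ball s0 \<epsilon>) f"
    and dom: "\<And>r. r \<in> {a..b} \<Longrightarrow> dist r s0 < \<epsilon> \<Longrightarrow> \<gamma> r \<in> chart_dom c"
    and map: "\<And>r. r \<in> {a..b} \<Longrightarrow> dist r s0 < \<epsilon> \<Longrightarrow> chart_map c (\<gamma> r) = f r"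
    and causal: "\<And>r. r \<in> {a..b} \<Longrightarrow> dist r s0 < \<epsilon> \<Longrightarrow> future_causal S c (\<gamma> r) (vector_derivative f (at r))"
    using curve_segment_coordinates[OF seg s0] by metis
  define f' where "f' r = vector_derivative f (at r)" for r
  \<comment> \<open>The time direction is frozen at \<open>s0\<close>, so that the perturbation is
    affine in coordinates.\<close>
  define T where "T = coord_time_dir c (f s0)"
  \<comment> \<open>Halving the gain at \<open>s0\<close> leaves a strict inequality that persists
    nearby.\<close>
  define \<kappa> where "\<kappa> = - coord_metric c (f s0) T (f' s0) / 2"
  have range: "f r \<in> chart_range c" and inv: "chart_inv c (f r) = \<gamma> r"
    if "r \<in> {a..b}" "dist r s0 < \<epsilon>" for r
    using dom[OF that] map[OF that] c by (metis imageI, metis chart_inv_map)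
  have null: "coord_metric c (f r) (f' r) (f' r) \<le> 0"
    and future: "coord_metric c (f r) (coord_time_dir c (f r)) (f' r) < 0"
    if "r \<in> {a..b}" "dist r s0 < \<epsilon>" for r
    using causal[OF that] inv[OF that]
    by (auto simp: future_causal_def coord_metric_def coord_time_dir_def f'_def)
  have x0: "f s0 \<in> chart_range c"
    using range[OF s0] \<epsilon> by simp
  have \<kappa>: "\<kappa> > 0" "coord_metric c (f s0) T (f' s0) < - \<kappa>"
    using future[OF s0] \<epsilon> by (auto simp: \<kappa>_def T_def)
  let ?D = "chart_range c \<times> (UNIV :: 'b set)"
  \<comment> \<open>Three open conditions are collected: a uniform gain in the mixed term,
    \<open>T\<close> being timelike, and the vector being future directed with respect to the
    varying time direction.\<close>
  define O1 where "O1 = (?D \<inter> (\<lambda>z. coord_metric c (fst z) T (snd z)) -` {..< - \<kappa>}) \<inter>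
    (?D \<inter> (\<lambda>z. coord_metric c (fst z) T T) -` {..<0}) \<inter>
    (?D \<inter> (\<lambda>z. coord_metric c (fst z) (coord_time_dir c (fst z)) (snd z)) -` {..<0})"
  have D: "open ?D"
    using open_range[OF c] by (simp add: open_Times)
  have "continuous_on ?D (\<lambda>z. coord_time_dir c (fst z))"
    by (rule continuous_on_compose2[OF continuous_coord_time_dir[OF c]]) (auto intro: continuous_intros)
  then have cont: "continuous_on ?D (\<lambda>z. coord_metric c (fst z) T (snd z))"
    "continuous_on ?D (\<lambda>z. coord_metric c (fst z) T T)"
    "continuous_on ?D (\<lambda>z. coord_metric c (fst z) (coord_time_dir c (fst z)) (snd z))"
    by (auto intro!: continuous_coord_metric[OF c] continuous_intros)
  have "open O1"
    unfolding O1_def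
    by (intro open_Int[OF open_Int] continuous_open_preimage[OF _ D open_lessThan] cont)
  moreover have "(f s0, f' s0) \<in> O1"
    using x0 \<kappa> future[OF s0] \<epsilon> coord_time_dir_timelike[OF c x0] by (auto simp: O1_def T_def)
  ultimately obtain A B where AB: "open A" "open B" "(f s0, f' s0) \<in> A \<times> B" "A \<times> B \<subseteq> O1"
    by (rule open_prod_elim)
  obtain r1 where r1: "r1 > 0" "ball (f s0) r1 \<subseteq> A"
    using AB(1,3) open_contains_ball by (metis mem_Sigma_iff)
  obtain r2 where r2: "r2 > 0" "ball (f' s0) r2 \<subseteq> B"
    using AB(2,3) open_contains_ball by (metis mem_Sigma_iff)
  obtain r3 L where r3: "r3 > 0" "ball (f s0) r3 \<subseteq> chart_range c" and L: "L \<ge> 0"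
    and Lip: "\<And>x y w. x \<in> ball (f s0) r3 \<Longrightarrow> y \<in> ball (f s0) r3 \<Longrightarrow>
      coord_metric c y w w \<le> coord_metric c x w w + L * norm (y - x) * (norm w)\<^sup>2"
    using coord_metric_locally_Lipschitz[OF c x0] by metis
  define r where "r = min r1 (min r2 r3)"
  have r: "r > 0" "r \<le> r1" "r \<le> r2" "r \<le> r3"
    using r1 r2 r3 by (auto simp: r_def)
  have near: "coord_metric c x T w < - \<kappa>" "coord_metric c x T T < 0"
    "coord_metric c x (coord_time_dir c x) w < 0" "x \<in> chart_range c"
    if "x \<in> ball (f s0) r" "w \<in> ball (f' s0) r" for x w
  proof -
    have "x \<in> ball (f s0) r1" "w \<in> ball (f' s0) r2"
      using that r by auto
    then have "(x, w) \<in> O1"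
      using AB(4) r1(2) r2(2) by blast
    then show "coord_metric c x T w < - \<kappa>" "coord_metric c x T T < 0"
      "coord_metric c x (coord_time_dir c x) w < 0" "x \<in> chart_range c"
      by (auto simp: O1_def)
  qed
  \<comment> \<open>At parameter \<open>s\<close> the base point moves by
    \<open>e * (v - s) * norm T\<close>, and the speed is at most \<open>norm (f' s0) + r\<close>.
    Hence the Lipschitz loss is at most \<open>e * (v - s) * M\<close>.\<close>
  define M where "M = L * norm T * (norm (f' s0) + r)\<^sup>2"
  have M: "M \<ge> 0"
    using L by (simp add: M_def)
  have "isCont f s0"
    using smooth_on_continuous[OF smooth] \<epsilon> by (simp add: continuous_on_eq_continuous_at)
  then obtain d1 where d1: "d1 > 0" "\<And>s. dist s s0 < d1 \<Longrightarrow> dist (f s) (f s0) < r / 2"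
    using r(1) unfolding continuous_at_eps_delta by (metis half_gt_zero)
  have "isCont f' s0"
    using smooth_on_vector_derivative_continuous[OF smooth] \<epsilon>
    by (simp add: continuous_on_eq_continuous_at f'_def[abs_def])
  then obtain d2 where d2: "d2 > 0" "\<And>s. dist s s0 < d2 \<Longrightarrow> dist (f' s) (f' s0) < r / 2"
    using r(1) unfolding continuous_at_eps_delta by (metis half_gt_zero)
  \<comment> \<open>The last bound limits the loss, since it yields
    \<open>d * M \<le> \<kappa>\<close>; the others keep the curve and its velocity near their
    values at \<open>s0\<close>.\<close>
  define d where "d = min \<epsilon> (min d1 (min d2 (\<kappa> / (M + 1))))"
  have d: "d > 0" "d \<le> \<epsilon>" "d \<le> d1" "d \<le> d2" "d \<le> \<kappa> / (M + 1)"
    using \<epsilon> d1(1) d2(1) \<kappa>(1) M by (auto simp: d_def)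
  have dM: "d * M \<le> \<kappa>"
  proof -
    have "d * M \<le> d * (M + 1)"
      using d(1) by simp
    also have "\<dots> \<le> \<kappa>"
      using d(5) M by (simp add: pos_le_divide_eq)
    finally show ?thesis .
  qed
  have "\<gamma> u \<in> closure {z. chronology S z (\<gamma> v)}"
    if uv: "a \<le> u" "u \<le> s0" "s0 \<le> v" "v \<le> b" "v - u < d" for u v
  proof (cases "u = v")
    case True
    then show ?thesis
      using in_closure_chronological_past by simp
  next
    case False
    then have "u < v"
      using uv by simp
    have s: "s \<in> {a..b}" "dist s s0 < d" if "s \<in> {u..v}" for s
      using that uv by (auto simp: dist_real_def)
    have u: "u \<in> {u..v}" and v: "v \<in> {u..v}"
      using \<open>u < v\<close> by auto
    show ?thesis
      unfolding in_closure_Collect_iff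
    proof (intro allI impI)
      fix V assume V: "open V" "\<gamma> u \<in> V"
      obtain \<rho> where \<rho>: "\<rho> > 0" "\<And>y. y \<in> ball (f u) \<rho> \<Longrightarrow> chart_inv c y \<in> V"
        using chart_inv_neighbourhood[OF c range[of u] V(1)] V(2) inv[of u] s[OF u] d(2) by auto
      \<comment> \<open>The denominator exceeds both \<open>norm T\<close> and
        \<open>norm T * (v - u)\<close>. Thus velocity and position move by less than
        \<open>r / 2\<close>, and the start moves by less than \<open>\<rho>\<close>, which keeps it
        in \<open>V\<close>.\<close>
      define e where "e = min (r / 2) \<rho> / ((norm T + 1) * (1 + (v - u)))"
      have pos: "(norm T + 1) * (1 + (v - u)) > 0"
        using \<open>u < v\<close> by (simp add: add_nonneg_pos)
      have e: "e > 0"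
        using r(1) \<rho>(1) pos by (simp add: e_def)
      have "e * ((norm T + 1) * (1 + (v - u))) = min (r / 2) \<rho>"
        using pos e_def by (metis less_irrefl nonzero_divide_eq_eq)
      moreover have "(norm T + 1) * (1 + (v - u)) = norm T + norm T * (v - u) + 1 + (v - u)"
        by (simp add: algebra_simps)
      then have "norm T < (norm T + 1) * (1 + (v - u))" "norm T * (v - u) < (norm T + 1) * (1 + (v - u))"
        using \<open>u < v\<close> mult_nonneg_nonneg[OF norm_ge_zero[of T], of "v - u"] norm_ge_zero[of T] by linarith+
      then have "e * norm T < e * ((norm T + 1) * (1 + (v - u)))"
        "e * (norm T * (v - u)) < e * ((norm T + 1) * (1 + (v - u)))"
        using mult_strict_left_mono[OF _ e] by blast+
      ultimately have eT: "e * norm T < r / 2" "e * norm T * (v - u) < min (r / 2) \<rho>"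
        by (auto simp: mult.assoc)
      \<comment> \<open>This form displays a sum with an affine map, for which smoothness is known.
        The displacement \<open>- e * (v - s)\<close> times \<open>T\<close> vanishes at
        \<open>v\<close>, so only the start of the curve moves.\<close>
      define g where "g s = f s + (- (e * v) *\<^sub>R T + s *\<^sub>R (e *\<^sub>R T))" for s
      have g: "g s = f s - (e * (v - s)) *\<^sub>R T" for s
        by (simp add: g_def algebra_simps)
      have smooth_g: "smooth_on (ball s0 \<epsilon>) g"
        unfolding g_def by (intro smooth_on_add smooth smooth_on_affine) simp
      have g': "vector_derivative g (at s) = f' s + e *\<^sub>R T" if "s \<in> ball s0 \<epsilon>" for s
        unfolding g_def f'_def
        by (intro vector_derivative_at has_vector_derivative_add smooth_on_has_vector_derivative[OF smooth that])
          (auto intro!: derivative_eq_intros)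
      have cone: "(g s, vector_derivative g (at s)) \<in> timelike_cone c" if "s \<in> {u..v}" for s
      proof -
        let ?w = "f' s"
        have fs: "dist (f s) (f s0) < r / 2" and f's: "dist (f' s) (f' s0) < r / 2"
          using d1(2)[of s] d2(2)[of s] s[OF that] d by auto
        have gf: "norm (g s - f s) = e * (v - s) * norm T"
          using e that by (simp add: g)
        also have "\<dots> \<le> e * norm T * (v - u)"
          using e that by (simp add: mult_left_mono mult_right_mono mult.commute mult.left_commute)
        finally have gf_le: "norm (g s - f s) \<le> e * norm T * (v - u)" .
        have "dist (g s) (f s0) < r"
          using fs gf_le eT(2) dist_triangle[of "g s" "f s0" "f s"] by (simp add: dist_norm)
        then have gs: "g s \<in> ball (f s0) r"
          by (simp add: dist_commute)
        have w: "?w \<in> ball (f' s0) r"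
          using f's r(1) by (simp add: dist_commute)
        have "dist (?w + e *\<^sub>R T) (f' s0) < r"
          using f's eT(1) e dist_triangle[of "?w + e *\<^sub>R T" "f' s0" ?w] by (simp add: dist_norm)
        then have wT: "?w + e *\<^sub>R T \<in> ball (f' s0) r"
          by (simp add: dist_commute)
        have gs_range: "g s \<in> chart_range c"
          using near(4)[OF gs w] .
        note bil = bilinear_coord_metric[OF c gs_range]
        have "norm ?w \<le> norm (f' s0) + r"
          using f's r(1) norm_triangle_sub[of ?w "f' s0"] by (simp add: dist_norm)
        then have w2: "(norm ?w)\<^sup>2 \<le> (norm (f' s0) + r)\<^sup>2"
          by (intro power_mono) auto
        have "coord_metric c (g s) ?w ?w \<le> coord_metric c (f s) ?w ?w + L * norm (g s - f s) * (norm ?w)\<^sup>2"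
          using fs gs r by (intro Lip) (auto simp: dist_commute)
        also have "\<dots> \<le> L * norm (g s - f s) * (norm (f' s0) + r)\<^sup>2"
          using null[of s] s[OF that] d(2) mult_left_mono[OF w2, of "L * norm (g s - f s)"] L by simp
        also have "\<dots> = e * ((v - s) * M)"
          by (simp add: gf M_def)
        also have "\<dots> \<le> e * (d * M)"
          using e M that uv by (intro mult_left_mono mult_right_mono) auto
        also have "\<dots> \<le> e * \<kappa>"
          using e dM by (intro mult_left_mono) auto
        finally have w_w: "coord_metric c (g s) ?w ?w \<le> e * \<kappa>" .
        \<comment> \<open>In this expansion the first term is at most \<open>e * \<kappa>\<close>,
          the second is below \<open>- 2 * e * \<kappa>\<close> and the third is negative.\<close>
        have "coord_metric c (g s) (?w + e *\<^sub>R T) (?w + e *\<^sub>R T)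
            = coord_metric c (g s) ?w ?w + 2 * e * coord_metric c (g s) T ?w + e * e * coord_metric c (g s) T T"
          using commute_coord_metric[OF c gs_range, of ?w T]
          by (simp add: bilinear_ladd[OF bil] bilinear_radd[OF bil] bilinear_lmul[OF bil] bilinear_rmul[OF bil]
              algebra_simps)
        moreover have "e * e * coord_metric c (g s) T T < 0" "e * coord_metric c (g s) T ?w < e * - \<kappa>"
          using e near(2)[OF gs w] mult_strict_left_mono[OF near(1)[OF gs w] e] by (simp_all add: mult_pos_neg)
        moreover have "e * \<kappa> > 0"
          using e \<kappa>(1) by simp
        ultimately have "coord_metric c (g s) (?w + e *\<^sub>R T) (?w + e *\<^sub>R T) < 0"
          using w_w by (simp add: mult.assoc)
        moreover have "s \<in> ball s0 \<epsilon>"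
          using s[OF that] d(2) by (simp add: dist_commute)
        ultimately show ?thesis
          using near(3)[OF gs wT] gs_range by (simp add: timelike_cone_def g')
      qed
      have sub: "{u..v} \<subseteq> ball s0 \<epsilon>"
        using s d(2) by (force simp: dist_commute)
      have "chronology S (chart_inv c (g u)) (chart_inv c (g v))"
        using chronology_in_chart[OF c \<open>u < v\<close> open_ball sub smooth_g cone] .
      moreover have "chart_inv c (g v) = \<gamma> v"
        using inv[of v] s[OF v] d(2) by (simp add: g)
      moreover have "chart_inv c (g u) \<in> V"
        using eT(2) e \<open>u < v\<close> by (intro \<rho>(2)) (simp add: g dist_norm mult.commute mult.left_commute)
      ultimately show "\<exists>z\<in>V. chronology S z (\<gamma> v)"
        by metis
    qed
  qed
  then show ?thesis
    using d(1) by blast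
qed

text \<open>The local statement around each parameter extends to the whole segment by bisection, as
  the relation is transitive. The guard in \<open>Q\<close> makes it hold trivially for intervals
  that leave \<open>{a..b}\<close>.\<close>

lemma causal_segment_in_closure:
  assumes seg: "curve_segment S (future_causal S) a b \<gamma>"
  shows "\<gamma> a \<in> closure {z. chronology S z (\<gamma> b)}"
proof -
  define Q where "Q u v \<longleftrightarrow> (a \<le> u \<and> v \<le> b \<longrightarrow> \<gamma> u \<in> closure {z. chronology S z (\<gamma> v)})" for u v
  have "Q a b"
  proof (rule Bolzano)
    show "a \<le> b"
      using seg by (simp add: curve_segment_def)
    show "Q u w" if "Q u v" "Q v w" "u \<le> v" "v \<le> w" for u v w
      using that closure_chronological_past_trans[of "\<gamma> u" "\<gamma> v" "\<gamma> w"] unfolding Q_def by auto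
    show "\<exists>d>0. \<forall>u v. u \<le> s \<and> s \<le> v \<and> v - u < d \<longrightarrow> Q u v" if "a \<le> s" "s \<le> b" for s
      using causal_segment_locally_in_closure[OF seg, of s] that unfolding Q_def by auto
  qed
  then show ?thesis
    by (simp add: Q_def)
qed

lemma causality_in_closure:
  assumes "causality S x y"
  shows "x \<in> closure {z. chronology S z y}"
proof -
  have "\<gamma> a \<in> closure {z. chronology S z (\<gamma> b)}" if "curve_chain S (future_causal S) \<gamma> a b" for a b \<gamma>
    using that
  proof (induction rule: curve_chain.induct)
    case (single a b)
    then show ?case
      by (rule causal_segment_in_closure)
  next
    case (step a b c)
    then show ?case
      using causal_segment_in_closure closure_chronological_past_trans by metis
  qed
  then show ?thesis
    using assms in_closure_chronological_past unfolding causality_iff_chain by metis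
qed

text \<open>The only condition to be checked is that a timelike vector is nonzero, and a bilinear
  form vanishes at zero.\<close>

lemma chronology_imp_causality:
  assumes "chronology S x y"
  shows "causality S x y"
proof -
  have "v \<noteq> 0" if "future_timelike S c p v" "c \<in> charts S" "p \<in> chart_dom c" for c p v
    using bilinear_lzero[OF bilinear_coord_metric[OF that(2), of "chart_map c p"], of 0] that
    by (auto simp: coord_metric_def future_timelike_def)
  then have seg: "curve_segment S (future_causal S) a b \<gamma>" if "curve_segment S (future_timelike S) a b \<gamma>" for a b \<gamma>
    using that unfolding curve_segment_def future_causal_def
    by (metis future_timelike_def less_imp_le)
  have "curve_chain S (future_causal S) \<gamma> a b" if "curve_chain S (future_timelike S) \<gamma> a b" for a b \<gamma>
    using that by (induction rule: curve_chain.induct) (auto intro: curve_chain.intros seg)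
  then show ?thesis
    using assms unfolding chronology_iff_chain causality_iff_chain by metis
qed

end

section \<open>Refining paths\<close>

lemma is_path_Cons:
  assumes "is_path le (P # P' # ps)"
  shows "open P" "le P P'" "is_path le (P' # ps)"
proof -
  have open_nonempty: "open ((P # P' # ps) ! n) \<and> (P # P' # ps) ! n \<noteq> {}" if "n < length (P # P' # ps)" for n
    using assms that unfolding is_path_def by blast
  have le: "le ((P # P' # ps) ! n) ((P # P' # ps) ! Suc n)" if "Suc n < length (P # P' # ps)" for n
    using assms that unfolding is_path_def by blast
  show "open P" "le P P'"
    using open_nonempty[of 0] le[of 0] by simp_all
  show "is_path le (P' # ps)"
    unfolding is_path_def
  proof (intro conjI allI impI)
    fix n
    show "open ((P' # ps) ! n)" "(P' # ps) ! n \<noteq> {}" if "n < length (P' # ps)"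
      using open_nonempty[of "Suc n"] that by simp_all
    show "le ((P' # ps) ! n) ((P' # ps) ! Suc n)" if "Suc n < length (P' # ps)"
      using le[of "Suc n"] that by simp
  qed simp
qed

lemma open_down_cone: "open (down_cone le U)"
  unfolding down_cone_def by (rule open_Union) simp

context spacetime_manifold
begin

section \<open>Past cones and chronological chains along a path\<close>

abbreviation causal_le :: "'a set \<Rightarrow> 'a set \<Rightarrow> bool" where
  "causal_le \<equiv> egli_milner (causality S)"

lemma causality_refl: "causality S x x"
  by (simp add: causality_def)

lemma causality_approximation:
  assumes "causality S x y" "open V" "x \<in> V"
  shows "\<exists>z\<in>V. chronology S z y"
  using causality_in_closure[OF assms(1)] assms(2,3) unfolding in_closure_Collect_iff by metis

text \<open>The witness in the cone is the union of the chronological past with \<open>V\<close>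
  itself. It is open, and including \<open>V\<close> reduces the second half of the Egli-Milner
  order to reflexivity.\<close>

lemma past_set_subset_down_cone:
  assumes "open V"
  shows "past_set (chronology S) V \<subseteq> down_cone causal_le V"
proof -
  have "past_set (chronology S) V = (\<Union>y\<in>V. {x. chronology S x y})"
    by (auto simp: past_set_def)
  then have "open (past_set (chronology S) V \<union> V)"
    using assms open_chronological_past by (simp add: open_Un open_UN)
  moreover have "causal_le (past_set (chronology S) V \<union> V) V"
    using chronology_imp_causality causality_refl
    by (auto simp: egli_milner_def past_set_def future_set_def)
  ultimately show ?thesis
    by (auto simp: down_cone_def)
qed

text \<open>The chain is built backwards from the endpoint. The order supplies a causal predecessor
  in the previous step, and since that step is open the predecessor can be replaced by a
  chronological one.\<close>

lemma path_chronological_chain: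
  "is_path causal_le p \<Longrightarrow> x \<in> last p \<Longrightarrow>
    \<exists>xs. list_all2 (\<in>) xs p \<and> sorted_wrt (chronology S) xs \<and> last xs = x"
proof (induction p rule: induct_list012)
  case 1
  then show ?case
    by (simp add: is_path_def)
next
  case (2 P)
  then show ?case
    by (intro exI[of _ "[x]"]) simp
next
  case (3 P P' ps)
  obtain xs where xs: "list_all2 (\<in>) xs (P' # ps)" "sorted_wrt (chronology S) xs" "last xs = x"
    using "3.IH"(2) is_path_Cons(3)[OF "3.prems"(1)] "3.prems"(2) by auto
  obtain x' xs' where xs_eq: "xs = x' # xs'" and x': "x' \<in> P'"
    using xs(1) by (cases xs) auto
  obtain w where "w \<in> P" "causality S w x'"
    using is_path_Cons(2)[OF "3.prems"(1)] x' by (auto simp: egli_milner_def future_set_def)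
  then obtain z where z: "z \<in> P" "chronology S z x'"
    using causality_approximation is_path_Cons(1)[OF "3.prems"(1)] by metis
  have "sorted_wrt (chronology S) (z # xs)"
    using xs(2) z(2) chronology_trans[OF z(2)] unfolding xs_eq by simp
  then show ?case
    using xs z(1) xs_eq by (intro exI[of _ "z # xs"]) simp
qed

text \<open>The recursively defined restriction is bounded from below by sets that mention only the
  path and the chain. By induction the next chain point lies in the open next step of the
  restriction, so everything chronologically before it lies in the down cone of that step.\<close>

lemma path_restrict_chronological_chain:
  assumes "p \<noteq> []" "list_all2 (\<in>) xs p" "sorted_wrt (chronology S) xs" "\<And>P. P \<in> set p \<Longrightarrow> open P"
    and "open W" "last xs \<in> W"
  defines "r \<equiv> path_restrict causal_le p W"
  shows "length r = length p \<and> last r = W \<and> (\<forall>P\<in>set r. open P) \<and> list_all2 (\<in>) xs r \<and>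
    (\<forall>n. Suc n < length p \<longrightarrow> p ! n \<inter> {z. chronology S z (xs ! Suc n)} \<subseteq> r ! n)"
  using assms(1-4,6) unfolding r_def
proof (induction p arbitrary: xs rule: induct_list012)
  case 1
  then show ?case
    by simp
next
  case (2 P)
  then show ?case
    using \<open>open W\<close> by (auto simp: list_all2_Cons2)
next
  case (3 P P' ps)
  obtain x x' xs' where xs: "xs = x # x' # xs'" "x \<in> P" "list_all2 (\<in>) (x' # xs') (P' # ps)"
    using "3.prems"(2) by (auto simp: list_all2_Cons2)
  define r where "r = path_restrict causal_le (P' # ps) W"
  have IH: "length r = length (P' # ps)" "last r = W" "\<And>P. P \<in> set r \<Longrightarrow> open P" "list_all2 (\<in>) (x' # xs') r"
    "\<And>n. Suc n < length (P' # ps) \<Longrightarrow> (P' # ps) ! n \<inter> {z. chronology S z ((x' # xs') ! Suc n)} \<subseteq> r ! n"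
    using "3.IH"(2)[of "x' # xs'"] "3.prems" xs unfolding r_def by auto
  obtain R r' where r: "r = R # r'"
    using IH(1) by (cases r) auto
  have "open R" "x' \<in> R"
    using IH(3,4) by (auto simp: r)
  then have cone: "{z. chronology S z x'} \<subseteq> down_cone causal_le R"
    using past_set_subset_down_cone[of R] by (auto simp: past_set_def)
  have restrict: "path_restrict causal_le (P # P' # ps) W = (P \<inter> down_cone causal_le R) # r"
    using r by (simp add: r_def Let_def)
  have "chronology S x x'"
    using "3.prems"(3) xs(1) by simp
  then have "list_all2 (\<in>) xs ((P \<inter> down_cone causal_le R) # r)"
    using cone xs IH(4) by auto
  moreover have "(P # P' # ps) ! n \<inter> {z. chronology S z (xs ! Suc n)} \<subseteq> ((P \<inter> down_cone causal_le R) # r) ! n"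
    if "Suc n < length (P # P' # ps)" for n
  proof (cases n)
    case 0
    then show ?thesis
      using cone xs(1) by auto
  next
    case (Suc m)
    then show ?thesis
      using IH(5)[of m] that xs(1) by simp
  qed
  moreover have "open (P \<inter> down_cone causal_le R)"
    using "3.prems"(4) open_down_cone by (intro open_Int) auto
  ultimately show ?case
    unfolding restrict using IH(1-3) r by auto
qed

section \<open>Timelike curves through chains of points\<close>

lemma chronology_curve:
  assumes "chronology S x y"
  shows "\<exists>\<gamma> a b. curve_chain S (future_timelike S) \<gamma> a b \<and> \<gamma> a = x \<and> \<gamma> b = y \<and>
    (\<forall>z\<in>\<gamma> ` {a..b}. z = x \<or> z = y \<or> chronology S x z \<and> chronology S z y)"
proof -
  obtain a b \<gamma> where \<gamma>: "curve_chain S (future_timelike S) \<gamma> a b" "\<gamma> a = x" "\<gamma> b = y"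
    using assms unfolding chronology_iff_chain by metis
  have "\<gamma> s = x \<or> \<gamma> s = y \<or> chronology S x (\<gamma> s) \<and> chronology S (\<gamma> s) y" if "s \<in> {a..b}" for s
  proof (cases "s = a \<or> s = b")
    case False
    then have "curve_chain S (future_timelike S) \<gamma> a s" "curve_chain S (future_timelike S) \<gamma> s b"
      using curve_chain_split[OF \<gamma>(1), of s] that by auto
    then show ?thesis
      unfolding chronology_iff_chain using \<gamma>(2,3) by metis
  qed (use \<gamma> in auto)
  with \<gamma> show ?thesis
    by (intro exI[of _ \<gamma>] exI[of _ a] exI[of _ b]) auto
qed

text \<open>Timelike curves between consecutive points are concatenated. A point of the curve other
  than \<open>x\<close> and the chain points falls into a gap, recorded as a cut
  \<open>us @ vs\<close>; the right part is never empty because the curve ends at the last chain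
  point.\<close>

lemma chronological_chain_curve:
  assumes "sorted_wrt (chronology S) xs" "xs \<noteq> []" "chronology S x (hd xs)"
  shows "\<exists>\<gamma> a b. curve_chain S (future_timelike S) \<gamma> a b \<and> \<gamma> a = x \<and> \<gamma> b = last xs \<and>
    (\<forall>y\<in>\<gamma> ` {a..b}. y = x \<or> y \<in> set xs \<or> chronology S x y \<and>
      (\<exists>us vs. xs = us @ vs \<and> vs \<noteq> [] \<and> (\<forall>u\<in>set us. chronology S u y) \<and> (\<forall>v\<in>set vs. chronology S y v)))"
  using assms
proof (induction xs arbitrary: x)
  case (Cons x1 xs)
  let ?between = "\<lambda>xs y. \<exists>us vs. xs = us @ vs \<and> vs \<noteq> [] \<and>
    (\<forall>u\<in>set us. chronology S u y) \<and> (\<forall>v\<in>set vs. chronology S y v)"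
  obtain \<gamma> a b where \<gamma>: "curve_chain S (future_timelike S) \<gamma> a b" "\<gamma> a = x" "\<gamma> b = x1"
    and y: "\<And>y. y \<in> \<gamma> ` {a..b} \<Longrightarrow> y = x \<or> y = x1 \<or> chronology S x y \<and> chronology S y x1"
    using chronology_curve[of x x1] Cons.prems(3) by auto
  have before: "?between (x1 # xs) y" if "chronology S y x1" for y
    using that chronology_trans[OF that] Cons.prems(1)
    by (intro exI[of _ "[]"] exI[of _ "x1 # xs"]) auto
  show ?case
  proof (cases "xs = []")
    case True
    then show ?thesis
      using \<gamma> y before by (intro exI[of _ \<gamma>] exI[of _ a] exI[of _ b]) auto
  next
    case False
    have "sorted_wrt (chronology S) xs" "chronology S x1 (hd xs)"
      using Cons.prems(1) False by simp_all
    from Cons.IH[OF this(1) False this(2)]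
    obtain \<gamma>' a' b' where \<gamma>': "curve_chain S (future_timelike S) \<gamma>' a' b'" "\<gamma>' a' = x1" "\<gamma>' b' = last xs"
      and y': "\<And>y. y \<in> \<gamma>' ` {a'..b'} \<Longrightarrow> y = x1 \<or> y \<in> set xs \<or> chronology S x1 y \<and> ?between xs y"
      by metis
    \<comment> \<open>Since \<open>x1\<close> precedes \<open>y\<close>, it joins the left part of
      the cut.\<close>
    have after: "?between (x1 # xs) y" if x1_y: "chronology S x1 y" and between: "?between xs y" for y
    proof -
      obtain us vs where "xs = us @ vs" "vs \<noteq> []" "\<forall>u\<in>set us. chronology S u y" "\<forall>v\<in>set vs. chronology S y v"
        using between by metis
      with x1_y show ?thesis
        by (intro exI[of _ "x1 # us"] exI[of _ vs]) auto
    qed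
    obtain \<gamma>'' c where \<gamma>'': "curve_chain S (future_timelike S) \<gamma>'' a c" "\<gamma>'' a = \<gamma> a" "\<gamma>'' c = \<gamma>' b'"
      "\<gamma>'' ` {a..c} \<subseteq> \<gamma> ` {a..b} \<union> \<gamma>' ` {a'..b'}"
      using curve_chain_join[OF \<gamma>(1) \<gamma>'(1)] \<gamma>(3) \<gamma>'(2) by auto
    have x_x1: "chronology S x x1"
      using Cons.prems(3) by simp
    have "y = x \<or> y \<in> set (x1 # xs) \<or> chronology S x y \<and> ?between (x1 # xs) y" if "y \<in> \<gamma>'' ` {a..c}" for y
    proof -
      have "y \<in> \<gamma> ` {a..b} \<or> y \<in> \<gamma>' ` {a'..b'}"
        using that \<gamma>''(4) by blast
      then show ?thesis
      proof
        assume "y \<in> \<gamma> ` {a..b}"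
        then consider "y = x" | "y = x1" | "chronology S x y" "chronology S y x1"
          using y by metis
        then show ?thesis
          using before by cases auto
      next
        assume "y \<in> \<gamma>' ` {a'..b'}"
        then consider "y = x1" | "y \<in> set xs" | "chronology S x1 y" "?between xs y"
          using y' by metis
        then show ?thesis
          using after chronology_trans[OF x_x1] by cases auto
      qed
    qed
    moreover have "\<gamma>'' a = x" "\<gamma>'' c = last (x1 # xs)"
      using \<gamma>''(2,3) \<gamma>(2) \<gamma>'(3) False by simp_all
    ultimately show ?thesis
      using \<gamma>''(1) by (intro exI[of _ \<gamma>''] exI[of _ a] exI[of _ c] conjI ballI)
  qed
qed simp

text \<open>The last clause is what refinement needs: each old point other than the last survives,
  and its new successor lies no later than its old one, so the new step at that point still precedes
  the old successor.\<close>

lemma chronological_chain_insert: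
  assumes xs: "sorted_wrt (chronology S) xs" "xs \<noteq> []"
    and y: "y \<in> set xs \<or> (\<exists>us vs. xs = us @ vs \<and> vs \<noteq> [] \<and>
      (\<forall>u\<in>set us. chronology S u y) \<and> (\<forall>v\<in>set vs. chronology S y v))"
  shows "\<exists>zs. sorted_wrt (chronology S) zs \<and> y \<in> set zs \<and> last zs = last xs \<and>
    (\<forall>n. Suc n < length xs \<longrightarrow> (\<exists>m. Suc m < length zs \<and> zs ! m = xs ! n \<and>
      (zs ! Suc m = xs ! Suc n \<or> chronology S (zs ! Suc m) (xs ! Suc n))))"
  using y
proof
  assume "y \<in> set xs"
  with xs show ?thesis
    by (intro exI[of _ xs]) auto
next
  assume "\<exists>us vs. xs = us @ vs \<and> vs \<noteq> [] \<and>
      (\<forall>u\<in>set us. chronology S u y) \<and> (\<forall>v\<in>set vs. chronology S y v)"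
  then obtain us vs where uvs: "xs = us @ vs" "vs \<noteq> []"
    "\<And>u. u \<in> set us \<Longrightarrow> chronology S u y" "\<And>v. v \<in> set vs \<Longrightarrow> chronology S y v"
    by metis
  let ?zs = "us @ y # vs"
  have "\<exists>m. Suc m < length ?zs \<and> ?zs ! m = xs ! n \<and>
      (?zs ! Suc m = xs ! Suc n \<or> chronology S (?zs ! Suc m) (xs ! Suc n))" if n: "Suc n < length xs" for n
  proof (cases "n < length us")
    case True
    show ?thesis
    proof (cases "Suc n < length us")
      case True
      then show ?thesis
        using n by (intro exI[of _ n]) (simp add: uvs(1) nth_append)
    next
      case False
      \<comment> \<open>This is the gap that receives \<open>y\<close>: the point before it gets
        \<open>y\<close> as its successor, and \<open>y\<close> precedes the head of
        \<open>vs\<close>.\<close>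
      then have "Suc n = length us"
        using True by simp
      then show ?thesis
        using uvs(2) uvs(4)[of "vs ! 0"] by (intro exI[of _ n]) (simp add: uvs(1) nth_append)
    qed
  next
    \<comment> \<open>Behind the inserted point all positions move up by one.\<close>
    case False
    then show ?thesis
      using n by (intro exI[of _ "Suc n"]) (simp add: uvs(1) nth_append Suc_diff_le)
  qed
  moreover have "sorted_wrt (chronology S) ?zs"
    using xs(1) uvs by (auto simp: sorted_wrt_append)
  ultimately show ?thesis
    using uvs(1,2) by (intro exI[of _ ?zs]) simp
qed

text \<open>Each step lies after the previous chain point and before the next one. As the chain
  points belong to their steps, they witness both halves of the order between neighbouring
  steps.\<close>

lemma chronological_chain_path:
  fixes V :: "'a \<Rightarrow> 'a set"
  assumes zs: "sorted_wrt (chronology S) zs" "zs \<noteq> []" and V: "\<And>z. open (V z)" "\<And>z. z \<in> V z"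
  shows "\<exists>q. is_path causal_le q \<and> length q = length zs \<and>
    (\<forall>i<length zs. zs ! i \<in> q ! i \<and> q ! i \<subseteq> V (zs ! i) \<and>
      (Suc i < length zs \<longrightarrow> q ! i \<subseteq> {z. chronology S z (zs ! Suc i)}))"
proof -
  \<comment> \<open>At the two ends of the chain the missing neighbour imposes no condition.\<close>
  define step where "step i = V (zs ! i) \<inter>
    (if i = 0 then UNIV else {z. chronology S (zs ! (i - 1)) z}) \<inter>
    (if Suc i < length zs then {z. chronology S z (zs ! Suc i)} else UNIV)" for i
  define q where "q = map step [0..<length zs]"
  have q: "length q = length zs" "\<And>i. i < length zs \<Longrightarrow> q ! i = step i"
    by (auto simp: q_def)
  have chain: "chronology S (zs ! i) (zs ! Suc i)" if "Suc i < length zs" for i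
    using sorted_wrt_nth_less[OF zs(1), of i "Suc i"] that by simp
  have mem: "zs ! i \<in> step i" if "i < length zs" for i
    using that V(2) chain[of i] chain[of "i - 1"] by (auto simp: step_def)
  have "open (step i)" for i
    using V(1) open_chronological_past open_chronological_future by (simp add: step_def open_Int)
  moreover have "causal_le (step i) (step (Suc i))" if i: "Suc i < length zs" for i
  proof -
    have "\<exists>y\<in>step (Suc i). causality S z y" if "z \<in> step i" for z
      using that i mem[OF i] chronology_imp_causality[of z "zs ! Suc i"] by (intro bexI[of _ "zs ! Suc i"]) (auto simp: step_def)
    moreover have "\<exists>y\<in>step i. causality S y z" if "z \<in> step (Suc i)" for z
      using that i mem[of i] chronology_imp_causality[of "zs ! i" z] by (intro bexI[of _ "zs ! i"]) (auto simp: step_def)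
    ultimately show ?thesis
      by (auto simp: egli_milner_def past_set_def future_set_def)
  qed
  ultimately have "is_path causal_le q"
    using mem zs(2) q unfolding is_path_def by (metis Suc_lessD empty_iff length_0_conv)
  moreover have "zs ! i \<in> q ! i \<and> q ! i \<subseteq> V (zs ! i) \<and>
      (Suc i < length zs \<longrightarrow> q ! i \<subseteq> {z. chronology S z (zs ! Suc i)})" if "i < length zs" for i
    using mem[OF that] q(2)[OF that] by (auto simp: step_def)
  ultimately show ?thesis
    using q(1) by metis
qed

text \<open>One such path through each point \<open>x\<close> yields a local past refinement. The
  covering condition provides a point of \<open>A\<close> on or before a timelike curve along a
  chain that ends at \<open>x\<close>; the chain enlarged by this point is thickened to a
  path.\<close>

lemma refining_path_exists:
  assumes A: "A \<in> Chron_minus S U" and p: "is_path causal_le p" "last p \<subseteq> U" and x: "x \<in> last p"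
  shows "\<exists>q. is_path causal_le q \<and> x \<in> last q \<and> last q \<subseteq> last p \<and>
    refines q (path_restrict causal_le p (last q)) \<and> inhabits q A"
proof -
  have open_A: "open A" and A_meets: "\<And>a b \<gamma>. curve_chain S (future_timelike S) \<gamma> a b \<Longrightarrow> \<gamma> b \<in> U \<Longrightarrow>
      (\<exists>y\<in>\<gamma> ` {a..b}. y \<in> A) \<or> (\<exists>y\<in>A. chronology S y (\<gamma> a))"
    using A unfolding Chron_minus_def timelike_curve_def piecewise_smooth_curve_iff_chain past_set_def
    by blast+
  have p_ne: "p \<noteq> []" and p_open: "\<And>P. P \<in> set p \<Longrightarrow> open P"
    using p(1) by (auto simp: is_path_def in_set_conv_nth)
  obtain xs where xs: "list_all2 (\<in>) xs p" "sorted_wrt (chronology S) xs" "last xs = x"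
    using path_chronological_chain[OF p(1) x] by metis
  have len: "length xs = length p"
    using xs(1) by (rule list_all2_lengthD)
  have xs_ne: "xs \<noteq> []"
    using len p_ne by auto
  have xs_p: "xs ! n \<in> p ! n" if "n < length p" for n
    using list_all2_nthD2[OF xs(1) that] .
  let ?between = "\<lambda>y. \<exists>us vs. xs = us @ vs \<and> vs \<noteq> [] \<and>
    (\<forall>u\<in>set us. chronology S u y) \<and> (\<forall>v\<in>set vs. chronology S y v)"
  \<comment> \<open>The chain may be a single point, whereas a timelike curve needs a nondegenerate
    interval; starting strictly earlier ensures that there is a curve.\<close>
  obtain x' where x': "chronology S x' (hd xs)"
    using causality_approximation[OF causality_refl open_UNIV UNIV_I] by metis
  have before: "?between y" if "chronology S y (hd xs)" for y
    using that chronology_trans[OF that] xs(2) xs_ne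
    by (intro exI[of _ "[]"] exI[of _ xs]) (cases xs, auto)
  obtain \<gamma> a b where \<gamma>: "curve_chain S (future_timelike S) \<gamma> a b" "\<gamma> a = x'" "\<gamma> b = last xs"
    and on_\<gamma>: "\<And>y. y \<in> \<gamma> ` {a..b} \<Longrightarrow> y = x' \<or> y \<in> set xs \<or> chronology S x' y \<and> ?between y"
    using chronological_chain_curve[OF xs(2) xs_ne x'] by metis
  have "\<gamma> b \<in> U"
    using \<gamma>(3) xs(3) x p(2) by auto
  \<comment> \<open>In either alternative of the covering condition, a point of \<open>A\<close>
    that is not in the chain can be inserted: \<open>x'\<close> and everything before it go in front
    of the chain, other points of the curve into their gap.\<close>
  from A_meets[OF \<gamma>(1) this] obtain y where y: "y \<in> A" "y \<in> set xs \<or> ?between y"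
  proof
    assume "\<exists>y\<in>\<gamma> ` {a..b}. y \<in> A"
    then obtain y where "y \<in> \<gamma> ` {a..b}" "y \<in> A"
      by metis
    then show thesis
      using on_\<gamma> before[OF x'] that by metis
  next
    assume "\<exists>y\<in>A. chronology S y (\<gamma> a)"
    then obtain y where "y \<in> A" "chronology S y x'"
      using \<gamma>(2) by metis
    then show thesis
      using before[OF chronology_trans[OF _ x']] that by metis
  qed
  obtain zs where zs: "sorted_wrt (chronology S) zs" "y \<in> set zs" "last zs = last xs"
    and zs_xs: "\<And>n. Suc n < length xs \<Longrightarrow> \<exists>m. Suc m < length zs \<and> zs ! m = xs ! n \<and>
      (zs ! Suc m = xs ! Suc n \<or> chronology S (zs ! Suc m) (xs ! Suc n))"
    using chronological_chain_insert[OF xs(2) xs_ne y(2)] by metis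
  have zs_ne: "zs \<noteq> []"
    using zs(2) by auto
  \<comment> \<open>A finite intersection of open sets, hence open. It keeps the step at a chain
    point inside the step of \<open>p\<close> containing that point, and the step at
    \<open>y\<close> inside \<open>A\<close>, also when both demands fall on one point.\<close>
  define V where "V z = \<Inter>{P \<in> insert A (set p). z \<in> P}" for z
  have "open (V z)" for z
    unfolding V_def using open_A p_open by (intro open_Inter) auto
  moreover have "z \<in> V z" for z
    by (simp add: V_def)
  ultimately obtain q where q: "is_path causal_le q" "length q = length zs"
    and mem: "\<And>i. i < length zs \<Longrightarrow> zs ! i \<in> q ! i"
    and sub_V: "\<And>i. i < length zs \<Longrightarrow> q ! i \<subseteq> V (zs ! i)"
    and sub_past: "\<And>i. Suc i < length zs \<Longrightarrow> q ! i \<subseteq> {z. chronology S z (zs ! Suc i)}"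
    using chronological_chain_path[OF zs(1) zs_ne, of V] by (metis Suc_lessD)
  have V_sub: "V z \<subseteq> P" if "z \<in> P" "P \<in> insert A (set p)" for z P
    using that by (auto simp: V_def)
  have q_ne: "q \<noteq> []"
    using q(2) zs_ne by auto
  let ?k = "length zs - 1"
  have last_q: "last q = q ! ?k" and last_zs: "zs ! ?k = x"
    using q_ne zs_ne q(2) zs(3) xs(3) by (simp_all add: last_conv_nth)
  have k: "?k < length zs"
    using zs_ne by simp
  have x_q: "x \<in> last q"
    using mem[OF k] last_q last_zs by simp
  have q_p: "last q \<subseteq> last p"
    using sub_V[OF k] V_sub[of x "last p"] x p_ne last_q last_zs by auto
  have open_q: "open (last q)"
    using q(1) k last_q q(2) by (simp add: is_path_def)
  define r where "r = path_restrict causal_le p (last q)"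
  have r: "length r = length p" "last r = last q"
    "\<And>n. Suc n < length p \<Longrightarrow> p ! n \<inter> {z. chronology S z (xs ! Suc n)} \<subseteq> r ! n"
    using path_restrict_chronological_chain[OF p_ne xs(1,2) p_open open_q] x_q xs(3) unfolding r_def
    by simp_all
  have "\<exists>m<length q. q ! m \<subseteq> r ! n" if n: "n < length r" for n
  proof (cases "Suc n < length p")
    case True
    then obtain m where m: "Suc m < length zs" "zs ! m = xs ! n"
      "zs ! Suc m = xs ! Suc n \<or> chronology S (zs ! Suc m) (xs ! Suc n)"
      using zs_xs[of n] len by auto
    \<comment> \<open>The step lies in \<open>p ! n\<close> by the choice of \<open>V\<close> and
      precedes the next chain point by transitivity, so the lower bound for the restriction
      applies.\<close>
    have "q ! m \<subseteq> p ! n"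
      using sub_V[of m] V_sub[OF xs_p[of n]] m n r(1) by auto
    moreover have "chronology S z (xs ! Suc n)" if "z \<in> q ! m" for z
      using sub_past[OF m(1)] m(3) chronology_trans[of S z "zs ! Suc m"] that by auto
    ultimately have "q ! m \<subseteq> r ! n"
      using r(3)[OF True] by blast
    then show ?thesis
      using m(1) q(2) by (intro exI[of _ m]) simp
  next
    \<comment> \<open>At the last index the restriction equals the endpoint of \<open>q\<close>, so
      the last step of \<open>q\<close> serves.\<close>
    case False
    then have "n = length r - 1" "r \<noteq> []"
      using n r(1) by auto
    then have "r ! n = last r"
      by (simp add: last_conv_nth)
    then show ?thesis
      using r(2) last_q k q(2) by (intro exI[of _ ?k]) simp
  qed
  then have "refines q r"
    by (simp add: refines_def)
  moreover have "inhabits q A"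
  proof -
    obtain m where "m < length zs" "zs ! m = y"
      using zs(2) by (metis in_set_conv_nth)
    then have "q ! m \<subseteq> A"
      using sub_V[of m] V_sub[of y A] y(1) by auto
    then show ?thesis
      using \<open>m < length zs\<close> q(2) unfolding inhabits_def by metis
  qed
  ultimately show ?thesis
    using q(1) x_q q_p unfolding r_def by metis
qed

end

theorem proposition7p7:
  fixes S :: "('a::{t2_space, second_countable_topology}, 'b::euclidean_space) spacetime"
    and U :: "'a set"
  assumes "smooth_spacetime S" and "open U"
  shows "Chron_minus S U \<subseteq> Cov_minus (egli_milner (causality S)) U"
proof
  interpret spacetime_manifold S
    using assms(1) by unfold_locales
  fix A assume A: "A \<in> Chron_minus S U"
  then have "open A" "A \<subseteq> down_cone causal_le U"
    using past_set_subset_down_cone[OF assms(2)] unfolding Chron_minus_def by auto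
  moreover have "\<exists>Q. local_past_refinement causal_le p Q \<and> (\<forall>q\<in>Q. inhabits q A)"
    if p: "is_path causal_le p" "lands_in p U" for p
  proof (intro exI conjI)
    \<comment> \<open>The family of all suitable paths needs no choice of one path for each point.
      Its endpoints lie in \<open>last p\<close> by definition and cover it by the existence of a
      path through every point.\<close>
    let ?Q = "{q. is_path causal_le q \<and> last q \<subseteq> last p \<and>
      refines q (path_restrict causal_le p (last q)) \<and> inhabits q A}"
    show "local_past_refinement causal_le p ?Q"
      unfolding local_past_refinement_def
    proof (intro conjI)
      show "(\<Union>q\<in>?Q. last q) = last p"
        using refining_path_exists[OF A p(1)] p(2) unfolding lands_in_def by fast
    qed simp_all
    show "\<forall>q\<in>?Q. inhabits q A"
      by simp
  qed
  ultimately show "A \<in> Cov_minus causal_le U"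
    by (simp add: Cov_minus_def)
qed

end
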